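(* Let $n\to\infty$, and suppose that the integers $p,q$, the edge set $\mathbf{E}_0$ and the matrix $\Theta_0$ (hence $\sigma^2_{\max},\lambda_{\max},\theta_0$) may vary with $n$, while $C>0$, $\kappa>0$ and $\gamma$ are fixed reals, such that: (i) $\mathbf{E}_0$ is decomposable and $|\mathbf{E}_0|\le q$; (ii) $\sigma^2_{\max}\lambda_{\max}\le C$; (iii) $p=O(n^{\kappa})$ and $p\to\infty$; (iv) $\gamma_0:=\gamma-\left(1-\frac{1}{4\kappa}\right)>0$; (v) $(p+2q)\log p\cdot\frac{\lambda_{\max}^2}{\theta_0^2}=o(n)$. Let $\mathcal{E}_1$ be the set of edge sets $\mathbf{E}$ on the $p$ nodes with $\mathbf{E}\not\supset\mathbf{E}_0$ and $|\mathbf{E}|\le q$. Then with probability tending to $1$ as $n\to\infty$, $$l_n(\Theta_0)-l_n(\hat\Theta(\mathbf{E}))>2q(\log p)(1+\gamma_0)\quad\text{for all }\mathbf{E}\in\mathcal{E}_1.$$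
   Context: An edge set $\mathbf{E}$ on $p$ nodes is a set of unordered pairs $\{j,k\}$ of distinct elements of $\{1,\dots,p\}$; it is identified with the Gaussian graphical model of all zero-mean normal distributions $N(0,\Theta^{-1})$ with $\Theta$ positive definite and $\Theta_{jk}=0$ whenever $j\neq k$ and $\{j,k\}\notin\mathbf{E}$. $\mathbf{E}$ is decomposable if the graph it defines is chordal. Let $\Theta_0$ be a $p\times p$ positive definite matrix whose nonzero entries are exactly the diagonal entries and the entries $(j,k),(k,j)$ for $\{j,k\}\in\mathbf{E}_0$. Let $X_1,\dots,X_n$ be i.i.d. $N(0,\Theta_0^{-1})$, $S=\frac1n\sum_i X_iX_i^T$, and $l_n(\Theta)=\frac n2[\log\det\Theta-\mathrm{trace}(S\Theta)]$. $\hat\Theta(\mathbf{E})$ denotes the maximum likelihood estimator of $\Theta$ in the model $\mathbf{E}$. Further, $\sigma^2_{\max}=\max_j(\Theta_0^{-1})_{jj}$, $\theta_0=\min_{\{j,k\}\in\mathbf{E}_0}|(\Theta_0)_{jk}|$, and $\lambda_{\max}$ is the largest eigenvalue of $\Theta_0$. *)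

theory Defs
  imports "HOL-Probability.Probability" "HOL-Library.Landau_Symbols"
    "Jordan_Normal_Form.Determinant" "Jordan_Normal_Form.Char_Poly"
begin

definition all_pairs :: "nat \<Rightarrow> nat set set" where
  "all_pairs p = {{j, k} | j k. j < p \<and> k < p \<and> j \<noteq> k}"

definition edge_set :: "nat \<Rightarrow> nat set set \<Rightarrow> bool" where
  "edge_set p E \<longleftrightarrow> E \<subseteq> all_pairs p"

definition is_cycle :: "nat set set \<Rightarrow> nat list \<Rightarrow> bool" where
  "is_cycle E vs \<longleftrightarrow> length vs \<ge> 3 \<and> distinct vs \<and>
     (\<forall>i < length vs. {vs ! i, vs ! ((i + 1) mod length vs)} \<in> E)"

definition decomposable :: "nat set set \<Rightarrow> bool" where
  "decomposable E \<longleftrightarrow> (\<forall>vs. is_cycle E vs \<and> length vs \<ge> 4 \<longrightarrow>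
     (\<exists>i < length vs. \<exists>j < length vs. i \<noteq> j \<and> j \<noteq> (i + 1) mod length vs \<and>
        i \<noteq> (j + 1) mod length vs \<and> {vs ! i, vs ! j} \<in> E))"

definition pos_def_mat :: "nat \<Rightarrow> real mat \<Rightarrow> bool" where
  "pos_def_mat p A \<longleftrightarrow> A \<in> carrier_mat p p \<and> transpose_mat A = A \<and>
     (\<forall>x \<in> carrier_vec p. x \<noteq> 0\<^sub>v p \<longrightarrow> x \<bullet> (A *\<^sub>v x) > 0)"

text \<open>The Gaussian graphical model of the edge set E (precision matrices).\<close>
definition ggm :: "nat \<Rightarrow> nat set set \<Rightarrow> real mat set" where
  "ggm p E = {A. pos_def_mat p A \<and>
     (\<forall>j < p. \<forall>k < p. j \<noteq> k \<and> {j, k} \<notin> E \<longrightarrow> A $$ (j, k) = 0)}"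

definition mat_trace :: "real mat \<Rightarrow> real" where
  "mat_trace A = (\<Sum>i < dim_row A. A $$ (i, i))"

text \<open>A sample X: X i j is coordinate j of observation i (i < n, j < p).\<close>
definition sample_cov :: "nat \<Rightarrow> nat \<Rightarrow> (nat \<Rightarrow> nat \<Rightarrow> real) \<Rightarrow> real mat" where
  "sample_cov n p X = mat p p (\<lambda>(j, k). (\<Sum>i < n. X i j * X i k) / real n)"

definition loglik :: "nat \<Rightarrow> nat \<Rightarrow> (nat \<Rightarrow> nat \<Rightarrow> real) \<Rightarrow> real mat \<Rightarrow> real" where
  "loglik n p X A = real n / 2 * (ln (det A) - mat_trace (sample_cov n p X * A))"

text \<open>Log-likelihood at the MLE of model E, i.e. the maximal value of l_n over the model
  (as an extended real; it is +infinity if the likelihood is unbounded on the model).\<close>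
definition mle_loglik :: "nat \<Rightarrow> nat \<Rightarrow> (nat \<Rightarrow> nat \<Rightarrow> real) \<Rightarrow> nat set set \<Rightarrow> ereal" where
  "mle_loglik n p X E = (SUP A \<in> ggm p E. ereal (loglik n p X A))"

definition gauss_density :: "nat \<Rightarrow> real mat \<Rightarrow> (nat \<Rightarrow> real) \<Rightarrow> real" where
  "gauss_density p A x = (2 * pi) powr (- real p / 2) * sqrt (det A) *
     exp (- (vec p x \<bullet> (A *\<^sub>v vec p x)) / 2)"

definition gauss_vec :: "nat \<Rightarrow> real mat \<Rightarrow> (nat \<Rightarrow> real) measure" where
  "gauss_vec p A = density (PiM {..<p} (\<lambda>_. lborel)) (\<lambda>x. ennreal (gauss_density p A x))"

definition sample_law :: "nat \<Rightarrow> nat \<Rightarrow> real mat \<Rightarrow> (nat \<Rightarrow> nat \<Rightarrow> real) measure" where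
  "sample_law n p A = PiM {..<n} (\<lambda>_. gauss_vec p A)"

definition cov_mat :: "nat \<Rightarrow> real mat \<Rightarrow> real mat" where
  "cov_mat p A = (SOME S. S \<in> carrier_mat p p \<and> inverts_mat A S)"

definition sigma2_max :: "nat \<Rightarrow> real mat \<Rightarrow> real" where
  "sigma2_max p A = Max {cov_mat p A $$ (j, j) | j. j < p}"

definition lambda_max :: "real mat \<Rightarrow> real" where
  "lambda_max A = Max {l. eigenvalue A l}"

definition theta_min :: "nat \<Rightarrow> real mat \<Rightarrow> nat set set \<Rightarrow> real" where
  "theta_min p A E = Min {\<bar>A $$ (j, k)\<bar> | j k. j < p \<and> k < p \<and> {j, k} \<in> E}"

end

theory Submission
  imports Defs
begin

text \<open>
  Let \<open>\<Theta>\<close> lie in a model \<open>E\<close> that misses an edge of \<open>E\<^sub>0\<close>, let \<open>D = \<Theta> - \<Theta>\<^sub>0\<close>, and let \<open>R\<close> be the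
  Frobenius norm of \<open>L\<^sup>-\<^sup>1 D L\<^sup>-\<^sup>T\<close>, where \<open>\<Theta>\<^sub>0 = L L\<^sup>T\<close>. Diagonalising this matrix shows that
  the population part of the log-likelihood drops by at least \<open>n R\<^sup>2 / (4 (1 + R))\<close>, and a missing
  edge forces \<open>R \<ge> r = \<theta>\<^sub>0 / \<lambda>\<^sub>m\<^sub>a\<^sub>x\<close>. Since \<open>D\<close> has at most \<open>p + 4q\<close> nonzero entries, the random part is at
  most \<open>n/2 \<cdot> \<epsilon> \<surd>(p + 4q) \<lambda>\<^sub>m\<^sub>a\<^sub>x R\<close> once all entries of \<open>S\<close> are within \<open>\<epsilon>\<close> of \<open>\<Theta>\<^sub>0\<^sup>-\<^sup>1\<close>; this holds with
  probability at least \<open>1 - 4/p\<close> for \<open>\<epsilon>\<close> of order \<open>\<sigma>\<^sup>2\<^sub>m\<^sub>a\<^sub>x \<surd>(log p / n)\<close>. By (ii) and (v) the random part is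
  then negligible and a gap of \<open>n r\<^sup>2 / 16\<close> remains, which by (v) exceeds any multiple of \<open>q log p\<close>.

  The tail bound is Chernoff's inequality: for \<open>v = u\<^sup>T \<Theta>\<^sub>0\<^sup>-\<^sup>1 u\<close> the moment generating function of
  \<open>(u\<^sup>T X)\<^sup>2 / 2\<close> is the ratio of the Gaussian normalising constants of \<open>\<Theta>\<^sub>0\<close> and \<open>\<Theta>\<^sub>0 - t u u\<^sup>T\<close>, that is
  \<open>(1 - t v)\<^sup>-\<^sup>1\<^sup>/\<^sup>2\<close>; taking \<open>u = e\<^sub>j \<plusminus> e\<^sub>k\<close> gives the entry \<open>(j, k)\<close> of \<open>S\<close> by polarisation.
\<close>

no_notation inner (infix "\<bullet>" 70)
no_notation vec_nth (infixl "$" 90)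

section \<open>Real symmetric and positive definite matrices\<close>

text \<open>The characteristic polynomial has a complex root \<open>k\<close>, with an eigenvector
  \<open>z = x + iy\<close>. Symmetry forces \<open>k\<close> to be real; then \<open>x\<close> and
  \<open>y\<close> both satisfy the eigenvector equation, and one of them is nonzero.\<close>

lemma symmetric_real_eigenvector:
  fixes A :: "real mat"
  assumes A: "A \<in> carrier_mat n n" and sym: "transpose_mat A = A" and n: "n > 0"
  obtains v a where "v \<in> carrier_vec n" "v \<noteq> 0\<^sub>v n" "A *\<^sub>v v = a \<cdot>\<^sub>v v"
proof -
  let ?B = "map_mat complex_of_real A"
  have B: "?B \<in> carrier_mat n n" using A by auto
  from char_poly_factorized[OF B] obtain as
    where as: "char_poly ?B = (\<Prod>a\<leftarrow>as. [:- a, 1:])" "length as = n" by auto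
  obtain k as' where "as = k # as'" using as(2) n by (cases as) auto
  then have "poly (char_poly ?B) k = 0" using as by simp
  then have "eigenvalue ?B k" using eigenvalue_root_char_poly[OF B] by simp
  then obtain z where z: "z \<in> carrier_vec n" "z \<noteq> 0\<^sub>v n" "?B *\<^sub>v z = k \<cdot>\<^sub>v z"
    unfolding eigenvalue_def eigenvector_def using B by auto
  define x where "x = map_vec Re z"
  define y where "y = map_vec Im z"
  have xy: "x \<in> carrier_vec n" "y \<in> carrier_vec n" using z by (auto simp: x_def y_def)
  have Bz: "(\<Sum>j = 0..<n. complex_of_real (A $$ (i, j)) * z $ j) = k * z $ i" if "i < n" for i
    using arg_cong[OF z(3), of "\<lambda>u. u $ i"] that A z(1)
    by (auto simp: scalar_prod_def)
  have Ax: "A *\<^sub>v x = Re k \<cdot>\<^sub>v x - Im k \<cdot>\<^sub>v y"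
  proof (rule eq_vecI)
    fix i assume "i < dim_vec (Re k \<cdot>\<^sub>v x - Im k \<cdot>\<^sub>v y)"
    then have i: "i < n" using xy by auto
    show "(A *\<^sub>v x) $ i = (Re k \<cdot>\<^sub>v x - Im k \<cdot>\<^sub>v y) $ i"
      using arg_cong[OF Bz[OF i], of Re] i A xy z(1)
      by (auto simp: scalar_prod_def x_def y_def)
  qed (use A xy in auto)
  have Ay: "A *\<^sub>v y = Re k \<cdot>\<^sub>v y + Im k \<cdot>\<^sub>v x"
  proof (rule eq_vecI)
    fix i assume "i < dim_vec (Re k \<cdot>\<^sub>v y + Im k \<cdot>\<^sub>v x)"
    then have i: "i < n" using xy by auto
    show "(A *\<^sub>v y) $ i = (Re k \<cdot>\<^sub>v y + Im k \<cdot>\<^sub>v x) $ i"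
      using arg_cong[OF Bz[OF i], of Im] i A xy z(1)
      by (auto simp: scalar_prod_def x_def y_def)
  qed (use A xy in auto)
  \<comment> \<open>When both sides are expanded, the \<open>Re k\<close> terms cancel and
    \<open>Im k\<close> times the squared norm of \<open>z\<close> remains.\<close>
  have "y \<bullet> (A *\<^sub>v x) = (A *\<^sub>v y) \<bullet> x"
    using transpose_vec_mult_scalar[OF A xy] sym by simp
  then have "y \<bullet> (Re k \<cdot>\<^sub>v x - Im k \<cdot>\<^sub>v y) = (Re k \<cdot>\<^sub>v y + Im k \<cdot>\<^sub>v x) \<bullet> x"
    unfolding Ax Ay .
  also have "y \<bullet> (Re k \<cdot>\<^sub>v x - Im k \<cdot>\<^sub>v y) = Re k * (y \<bullet> x) - Im k * (y \<bullet> y)"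
    using xy by (subst scalar_prod_minus_distrib[of _ n]) auto
  also have "(Re k \<cdot>\<^sub>v y + Im k \<cdot>\<^sub>v x) \<bullet> x = Re k * (y \<bullet> x) + Im k * (x \<bullet> x)"
    using xy by (subst add_scalar_prod_distrib[of _ n]) auto
  finally have im: "Im k * (x \<bullet> x + y \<bullet> y) = 0" by (simp add: algebra_simps)
  have sq: "u \<bullet> u \<ge> 0" for u :: "real vec" by (auto simp: scalar_prod_def intro!: sum_nonneg)
  have sq0: "u = 0\<^sub>v n" if "u \<bullet> u = 0" "u \<in> carrier_vec n" for u :: "real vec"
    using that conjugate_square_eq_0_vec[of u n] by (auto simp: scalar_prod_def)
  have nz: "x \<noteq> 0\<^sub>v n \<or> y \<noteq> 0\<^sub>v n"
  proof (rule ccontr)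
    assume "\<not> ?thesis"
    then have *: "x = 0\<^sub>v n" "y = 0\<^sub>v n" by auto
    have "z = 0\<^sub>v n"
    proof (rule eq_vecI)
      fix i assume "i < dim_vec (0\<^sub>v n :: complex vec)"
      then have i: "i < n" by auto
      show "z $ i = 0\<^sub>v n $ i"
        using arg_cong[OF *(1), of "\<lambda>u. u $ i"] arg_cong[OF *(2), of "\<lambda>u. u $ i"] i z(1)
        by (auto simp: x_def y_def complex_eq_iff)
    qed (use z in auto)
    with z(2) show False by simp
  qed
  then have "x \<bullet> x + y \<bullet> y \<noteq> 0" using sq[of x] sq[of y] sq0 xy by fastforce
  with im have k0: "Im k = 0" by simp
  show thesis
  proof (cases "x = 0\<^sub>v n")
    case False
    show thesis by (rule that[of x "Re k"]) (use xy False Ax k0 in auto)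
  next
    case True
    show thesis by (rule that[of y "Re k"]) (use xy nz True Ay k0 in auto)
  qed
qed

text \<open>Householder reflection along \<open>w = v - e_0\<close>, which exchanges the unit
  vectors \<open>v\<close> and \<open>e_0\<close>; if they coincide, the identity serves.\<close>

lemma orthogonal_reflection_to_unit_vector:
  fixes v :: "real vec"
  assumes v: "v \<in> carrier_vec n" and unit: "v \<bullet> v = 1" and n: "n > 0"
  obtains H where "H \<in> carrier_mat n n" "transpose_mat H = H" "H * H = 1\<^sub>m n" "col H 0 = v"
proof (cases "v = unit_vec n 0")
  case True
  show thesis by (rule that[of "1\<^sub>m n"]) (use True n in auto)
next
  case False
  define w where "w = v - unit_vec n 0"
  define c where "c = 2 / (w \<bullet> w)"
  define H where "H = mat n n (\<lambda>(i, j). (if i = j then 1 else 0) - c * w $ i * w $ j)"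
  have w: "w \<in> carrier_vec n" using v by (auto simp: w_def)
  have "w \<noteq> 0\<^sub>v n"
  proof
    assume "w = 0\<^sub>v n"
    then have "\<And>i. i < n \<Longrightarrow> v $ i = unit_vec n 0 $ i"
      using v unfolding w_def by (metis eq_iff_diff_eq_0 index_minus_vec(1) index_unit_vec(3) index_zero_vec(1))
    with v False show False by (auto intro!: eq_vecI)
  qed
  then have ww0: "w \<bullet> w \<noteq> 0"
    using conjugate_square_eq_0_vec[of w n] w by (auto simp: scalar_prod_def)
  have ww: "w \<bullet> w = 2 - 2 * v $ 0"
  proof -
    have "w \<bullet> w = v \<bullet> v - v \<bullet> unit_vec n 0 - (unit_vec n 0 \<bullet> v - unit_vec n 0 \<bullet> unit_vec n 0)"
      unfolding w_def using v
      by (simp add: minus_scalar_prod_distrib[of _ n] scalar_prod_minus_distrib[of _ n])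
    also have "\<dots> = 2 - 2 * v $ 0" using v n unit by simp
    finally show ?thesis .
  qed
  have cw: "c * (w \<bullet> w) = 2" using ww0 by (simp add: c_def)
  have H: "H \<in> carrier_mat n n" by (simp add: H_def)
  show thesis
  proof (rule that[OF H])
    show "transpose_mat H = H" by (rule eq_matI) (auto simp: H_def)
    show "H * H = 1\<^sub>m n"
    proof (rule eq_matI)
      fix i j assume "i < dim_row (1\<^sub>m n :: real mat)" "j < dim_col (1\<^sub>m n :: real mat)"
      then have ij: "i < n" "j < n" by auto
      have "(H * H) $$ (i, j) = (\<Sum>k = 0..<n. ((if i = k then 1 else 0) - c * w $ i * w $ k) *
               ((if k = j then 1 else 0) - c * w $ k * w $ j))"
        using ij by (simp add: H_def scalar_prod_def)
      also have "\<dots> = (\<Sum>k = 0..<n. (if i = k then (if k = j then 1 else 0) else 0)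
            - (if k = j then c * w $ i * w $ k else 0) - (if i = k then c * w $ k * w $ j else 0)
            + c * w $ i * w $ j * c * (w $ k * w $ k))"
        by (intro sum.cong) (auto simp: algebra_simps)
      also have "\<dots> = (if i = j then 1 else 0) - c * w $ i * w $ j - c * w $ i * w $ j
            + c * w $ i * w $ j * (c * (w \<bullet> w))"
        using ij w by (simp add: sum.distrib sum_subtractf scalar_prod_def sum_distrib_left mult.assoc)
      also have "\<dots> = (if i = j then 1 else 0)" unfolding cw by simp
      finally show "(H * H) $$ (i, j) = 1\<^sub>m n $$ (i, j)" using ij by simp
    qed (auto simp: H_def)
    \<comment> \<open>Since \<open>w \<bullet> w = 2 (1 - v_0)\<close> and
      \<open>w_0 = v_0 - 1\<close>, the product \<open>c * w_0\<close> is -1, so column 0 of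
      \<open>H\<close> is \<open>e_0 + w = v\<close>.\<close>
    have "1 - v $ 0 \<noteq> 0" using ww ww0 by auto
    then have "c * w $ 0 = -1" using ww v n by (simp add: c_def w_def field_simps)
    then have "(if i = 0 then 1 else 0) - c * w $ i * w $ 0 = v $ i" if "i < n" for i
      using that v n by (simp add: mult.assoc mult.left_commute[of c] w_def)
    then show "col H 0 = v" using v n by (intro eq_vecI) (auto simp: H_def)
  qed
qed

lemma dim_mat_diag [simp]: "dim_row (mat_diag n f) = n" "dim_col (mat_diag n f) = n"
  by (simp_all add: mat_diag_def)

text \<open>Deflation: a reflection carrying a unit eigenvector to \<open>e_0\<close> makes the
  matrix block diagonal, and the induction hypothesis diagonalises the lower block.\<close>

theorem spectral_theorem:
  fixes A :: "real mat"
  assumes "A \<in> carrier_mat n n" and "transpose_mat A = A"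
  shows "\<exists>P d. P \<in> carrier_mat n n \<and> transpose_mat P * P = 1\<^sub>m n \<and> P * transpose_mat P = 1\<^sub>m n \<and>
           A = P * mat_diag n d * transpose_mat P"
  using assms
proof (induction n arbitrary: A)
  case 0
  then show ?case by (intro exI[of _ "1\<^sub>m 0"] exI) (auto intro!: eq_matI)
next
  case (Suc n)
  let ?m = "Suc n"
  note A = Suc.prems(1) and sym = Suc.prems(2)
  obtain u a where u: "u \<in> carrier_vec ?m" "u \<noteq> 0\<^sub>v ?m" "A *\<^sub>v u = a \<cdot>\<^sub>v u"
    using symmetric_real_eigenvector[OF A sym] by auto
  have "u \<bullet> u \<ge> 0" by (auto simp: scalar_prod_def intro!: sum_nonneg)
  moreover have "u \<bullet> u \<noteq> 0"
    using u conjugate_square_eq_0_vec[of u ?m] by (auto simp: scalar_prod_def)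
  ultimately have uu: "u \<bullet> u > 0" by simp
  define v where "v = (1 / sqrt (u \<bullet> u)) \<cdot>\<^sub>v u"
  have v: "v \<in> carrier_vec ?m" using u by (simp add: v_def)
  have vv: "v \<bullet> v = 1" using uu u by (simp add: v_def power2_eq_square[symmetric])
  have Av: "A *\<^sub>v v = a \<cdot>\<^sub>v v"
    using u A by (simp add: v_def mult_mat_vec smult_smult_assoc mult.commute)
  obtain H where H: "H \<in> carrier_mat ?m ?m" "transpose_mat H = H" "H * H = 1\<^sub>m ?m" "col H 0 = v"
    using orthogonal_reflection_to_unit_vector[OF v vv] by auto
  define B where "B = H * A * H"
  have B: "B \<in> carrier_mat ?m ?m" using A H by (simp add: B_def)
  have Bsym: "transpose_mat B = B"
    using A H by (simp add: B_def transpose_mult[of _ ?m ?m _ ?m] sym assoc_mult_mat[of _ ?m ?m _ ?m _ ?m])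
  have Hv: "H *\<^sub>v v = unit_vec ?m 0"
  proof -
    have "col (H * H) 0 = H *\<^sub>v col H 0" using H by (intro col_mult2[of _ ?m ?m _ ?m]) auto
    then show ?thesis using H by simp
  qed
  have "col B 0 = (H * A) *\<^sub>v col H 0"
    unfolding B_def using A H by (intro col_mult2[of _ ?m ?m _ ?m]) auto
  also have "\<dots> = a \<cdot>\<^sub>v unit_vec ?m 0"
    using A H v Av Hv by (simp add: assoc_mult_mat_vec[of _ ?m ?m _ ?m] mult_mat_vec[of _ ?m ?m])
  finally have colB: "col B 0 = a \<cdot>\<^sub>v unit_vec ?m 0" .
  \<comment> \<open>Column 0 of \<open>B\<close> vanishes below the corner, and by symmetry row 0
    vanishes to its right.\<close>
  have B0: "B $$ (i, 0) = (if i = 0 then a else 0)" if "i < ?m" for i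
    using arg_cong[OF colB, of "\<lambda>w. w $ i"] that B by simp
  have Bs: "B $$ (i, j) = B $$ (j, i)" if "i < ?m" "j < ?m" for i j
    using arg_cong[OF Bsym, of "\<lambda>M. M $$ (i, j)"] that B by simp
  define A' where "A' = mat n n (\<lambda>(i, j). B $$ (Suc i, Suc j))"
  have A': "A' \<in> carrier_mat n n" by (simp add: A'_def)
  have "transpose_mat A' = A'"
    by (rule eq_matI) (auto simp: A'_def Bs)
  from Suc.IH[OF A' this] obtain P' d' where P': "P' \<in> carrier_mat n n"
    "transpose_mat P' * P' = 1\<^sub>m n" "P' * transpose_mat P' = 1\<^sub>m n"
    "A' = P' * mat_diag n d' * transpose_mat P'" by blast
  \<comment> \<open>\<open>F\<close> lets \<open>P'\<close> act on the coordinates after 0; the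
    required orthogonal matrix is \<open>H * F\<close>.\<close>
  define F where "F = four_block_mat (1\<^sub>m 1) (0\<^sub>m 1 n) (0\<^sub>m n 1) P'"
  define d where "d = (\<lambda>i. if i = 0 then a else d' (i - 1))"
  have F: "F \<in> carrier_mat ?m ?m" using four_block_carrier_mat[of "1\<^sub>m 1" 1 1 P' n n] P' by (simp add: F_def)
  have Ft: "transpose_mat F = four_block_mat (1\<^sub>m 1) (0\<^sub>m 1 n) (0\<^sub>m n 1) (transpose_mat P')"
    unfolding F_def using P' by (subst transpose_four_block_mat[of _ 1 1 _ n _ n]) auto
  have one: "four_block_mat (1\<^sub>m 1) (0\<^sub>m 1 n) (0\<^sub>m n 1) (1\<^sub>m n) = (1\<^sub>m ?m :: real mat)"
    by (rule eq_matI) auto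
  have FtF: "transpose_mat F * F = 1\<^sub>m ?m"
    unfolding Ft unfolding F_def using P'
    by (subst mult_four_block_mat[of _ 1 1 _ n _ n _ _ 1 _ n]) (auto simp: one)
  have FFt: "F * transpose_mat F = 1\<^sub>m ?m"
    unfolding Ft unfolding F_def using P'
    by (subst mult_four_block_mat[of _ 1 1 _ n _ n _ _ 1 _ n]) (auto simp: one)
  have D: "mat_diag ?m d = four_block_mat (mat_diag 1 (\<lambda>_. a)) (0\<^sub>m 1 n) (0\<^sub>m n 1) (mat_diag n d')"
    by (rule eq_matI) (auto simp: mat_diag_def d_def)
  have BF: "B = F * mat_diag ?m d * transpose_mat F"
  proof -
    have "F * mat_diag ?m d = four_block_mat (mat_diag 1 (\<lambda>_. a)) (0\<^sub>m 1 n) (0\<^sub>m n 1) (P' * mat_diag n d')"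
      unfolding D F_def using P'(1) by (subst mult_four_block_mat[of _ 1 1 _ n _ n _ _ 1 _ n]) auto
    also have "\<dots> * transpose_mat F = four_block_mat (mat_diag 1 (\<lambda>_. a)) (0\<^sub>m 1 n) (0\<^sub>m n 1) A'"
      unfolding Ft P'(4) using P'(1)
      by (subst mult_four_block_mat[of _ 1 1 _ n _ n _ _ 1 _ n]) (auto intro!: mult_carrier_mat[of _ n n _ n])
    also have "\<dots> = B"
      using B B0 Bs[of 0] by (intro eq_matI) (auto simp: A'_def mat_diag_def)
    finally show ?thesis by simp
  qed
  let ?P = "H * F"
  have P: "?P \<in> carrier_mat ?m ?m" using H F by simp
  have Pt: "transpose_mat ?P = transpose_mat F * H"
    using H F by (simp add: transpose_mult[of _ ?m ?m _ ?m])
  have cancel: "H * (H * X) = X" if "X \<in> carrier_mat ?m ?m" for X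
    using that H by (simp flip: assoc_mult_mat[of _ ?m ?m _ ?m _ ?m])
  have cancelF: "F * (transpose_mat F * X) = X" if "X \<in> carrier_mat ?m ?m" for X
    using that F FFt by (simp flip: assoc_mult_mat[of _ ?m ?m _ ?m _ ?m])
  have "transpose_mat ?P * ?P = 1\<^sub>m ?m"
    unfolding Pt using H F FtF by (simp add: assoc_mult_mat[of _ ?m ?m _ ?m _ ?m] cancel)
  moreover have "?P * transpose_mat ?P = 1\<^sub>m ?m"
    unfolding Pt using H F by (simp add: assoc_mult_mat[of _ ?m ?m _ ?m _ ?m] cancelF)
  moreover have "A = ?P * mat_diag ?m d * transpose_mat ?P"
  proof -
    have "A = H * (B * H)"
      unfolding B_def using A H by (simp add: assoc_mult_mat[of _ ?m ?m _ ?m _ ?m] cancel)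
    then show ?thesis
      unfolding BF Pt using H F
        by (simp add: assoc_mult_mat[of _ ?m ?m _ ?m _ ?m] mult_carrier_mat[of _ ?m ?m _ ?m])
  qed
  ultimately show ?case using P by blast
qed

section \<open>Eigenvalue formulas and a second-order bound for the logarithm\<close>

lemma det_mat_diag: "det (mat_diag n d) = (\<Prod>i<n. d i)" for d :: "nat \<Rightarrow> real"
proof -
  have "det (mat_diag n d) = prod_list (diag_mat (mat_diag n d))"
    by (rule det_upper_triangular[of _ n]) (auto simp: mat_diag_def)
  also have "diag_mat (mat_diag n d) = map d [0..<n]"
    by (auto simp: diag_mat_def mat_diag_def)
  finally show ?thesis by (simp add: prod.distinct_set_conv_list[symmetric] atLeast0LessThan)
qed

lemma mat_trace_mult_commute:
  assumes "A \<in> carrier_mat n m" "B \<in> carrier_mat m n"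
  shows "mat_trace (A * B) = mat_trace (B * A)"
proof -
  have "mat_trace (A * B) = (\<Sum>i<n. \<Sum>k<m. A $$ (i, k) * B $$ (k, i))"
    using assms by (auto simp: mat_trace_def scalar_prod_def atLeast0LessThan intro!: sum.cong)
  also have "\<dots> = (\<Sum>k<m. \<Sum>i<n. B $$ (k, i) * A $$ (i, k))"
    by (subst sum.swap) (simp add: mult.commute)
  also have "\<dots> = mat_trace (B * A)"
    using assms by (auto simp: mat_trace_def scalar_prod_def atLeast0LessThan intro!: sum.cong)
  finally show ?thesis .
qed

text \<open>The \<open>\<mu> i\<close> are the eigenvalues of \<open>M\<close>. Recording them as
  values of the quadratic form at unit vectors serves to deduce \<open>1 + \<mu> i > 0\<close> later
  from positive definiteness.\<close>

lemma det_one_plus_symmetric_diagonalized: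
  fixes M :: "real mat"
  assumes M: "M \<in> carrier_mat n n" "transpose_mat M = M"
  obtains \<mu> where "det (1\<^sub>m n + M) = (\<Prod>i<n. 1 + \<mu> i)" "mat_trace M = (\<Sum>i<n. \<mu> i)"
    "mat_trace (M * M) = (\<Sum>i<n. (\<mu> i)\<^sup>2)"
    "\<And>i. i < n \<Longrightarrow> \<exists>x \<in> carrier_vec n. x \<bullet> x = 1 \<and> x \<bullet> (M *\<^sub>v x) = \<mu> i"
proof -
  obtain P d where P: "P \<in> carrier_mat n n" "transpose_mat P * P = 1\<^sub>m n" "P * transpose_mat P = 1\<^sub>m n"
    and MP: "M = P * mat_diag n d * transpose_mat P"
    using spectral_theorem[OF M] by blast
  note as = assoc_mult_mat[of _ n n _ n _ n]
  have tr: "mat_trace (P * X * transpose_mat P) = mat_trace X" if "X \<in> carrier_mat n n" for X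
  proof -
    have "mat_trace (P * X * transpose_mat P) = mat_trace (transpose_mat P * (P * X))"
      using P that by (intro mat_trace_mult_commute) auto
    also have "transpose_mat P * (P * X) = X"
      using P that by (simp flip: as)
    finally show ?thesis .
  qed
  have cancel: "transpose_mat P * (P * X) = X" if "X \<in> carrier_mat n n" for X
    using P that by (simp flip: as)
  have I: "1\<^sub>m n + M = P * mat_diag n (\<lambda>i. 1 + d i) * transpose_mat P"
  proof -
    have "mat_diag n (\<lambda>i. 1 + d i) = 1\<^sub>m n + mat_diag n d"
      by (rule eq_matI) (auto simp: mat_diag_def)
    then show ?thesis
      unfolding MP using P by (simp add: mult_add_distrib_mat[of _ n n _ n] add_mult_distrib_mat[of _ n n _ _ n])
  qed
  have detP: "det P * det P = 1"
    using arg_cong[OF P(3), of det] P(1) by (simp add: det_mult[of _ n] det_transpose)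
  show thesis
  proof (rule that[of d])
    show "det (1\<^sub>m n + M) = (\<Prod>i<n. 1 + d i)"
      unfolding I using P detP by (simp add: det_mult[of _ n] det_transpose det_mat_diag)
    show "mat_trace M = (\<Sum>i<n. d i)"
      unfolding MP by (subst tr) (auto simp: mat_trace_def mat_diag_def)
    have "M * M = P * (mat_diag n (\<lambda>i. d i * d i)) * transpose_mat P"
      unfolding MP using P by (simp add: as cancel mult_carrier_mat[of _ n n _ n] flip: mat_diag_diag)
    then show "mat_trace (M * M) = (\<Sum>i<n. (d i)\<^sup>2)"
      by (simp add: tr) (auto simp: mat_trace_def mat_diag_def power2_eq_square)
    fix i assume i: "i < n"
    have c: "col P i \<in> carrier_vec n" by (rule carrier_vecI) (use P in auto)
    have "col P i \<bullet> col P i = (transpose_mat P * P) $$ (i, i)"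
      using P(1) i by simp
    then have cc: "col P i \<bullet> col P i = 1" using i P by simp
    have "M * P = P * mat_diag n d" unfolding MP using P by (simp add: as mult_carrier_mat[of _ n n _ n])
    then have "col (M * P) i = col (P * mat_diag n d) i" by simp
    also have "col (M * P) i = M *\<^sub>v col P i" using M P i by (intro col_mult2) auto
    also have "col (P * mat_diag n d) i = d i \<cdot>\<^sub>v col P i"
      using P i by (auto simp: mat_diag_mult_right[of _ n] intro!: eq_vecI)
    finally have "col P i \<bullet> (M *\<^sub>v col P i) = d i" using cc c by simp
    then show "\<exists>x \<in> carrier_vec n. x \<bullet> x = 1 \<and> x \<bullet> (M *\<^sub>v x) = d i" using c cc by blast
  qed
qed

text \<open>The difference of the two sides vanishes at 0, and its derivative
  \<open>y * (r - y) / ((1 + r) * (1 + y))\<close> is nonnegative for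
  \<open>0 \<le> y \<le> r\<close> and nonpositive for \<open>-1 < y \<le> 0\<close>. The factor
  \<open>1 + r\<close> pays for large \<open>x\<close>, where no fixed quadratic coefficient would
  do.\<close>

lemma ln_one_plus_le_quadratic:
  fixes x r :: real
  assumes "x > -1" "\<bar>x\<bar> \<le> r"
  shows "ln (1 + x) \<le> x - x\<^sup>2 / (2 * (1 + r))"
proof -
  have r: "r \<ge> 0" using assms by simp
  show ?thesis
  proof (cases "x \<ge> 0")
    case True
    let ?f = "\<lambda>y::real. y - y\<^sup>2 / (2 * (1 + r)) - ln (1 + y)"
    have "?f 0 \<le> ?f x"
    proof (rule DERIV_nonneg_imp_nondecreasing[OF True, where f = ?f])
      fix y :: real assume y: "0 \<le> y" "y \<le> x"
      have "(?f has_real_derivative 1 - 2 * y / (2 * (1 + r)) - 1 / (1 + y)) (at y)"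
        using y r by (auto intro!: derivative_eq_intros)
      moreover have "1 - 2 * y / (2 * (1 + r)) - 1 / (1 + y) = y * (r - y) / ((1 + r) * (1 + y))"
        using y r by (simp add: divide_simps) (simp add: algebra_simps)
      moreover have "\<dots> \<ge> 0" using y r assms by auto
      ultimately show "\<exists>d. (?f has_real_derivative d) (at y) \<and> 0 \<le> d" by metis
    qed
    then show ?thesis by simp
  next
    case False
    let ?f = "\<lambda>y::real. y - y\<^sup>2 / (2 * (1 + r)) - ln (1 + y)"
    have "?f 0 \<le> ?f x"
    proof (rule DERIV_nonpos_imp_nonincreasing[where f = ?f])
      show "x \<le> 0" using False by simp
      fix y :: real assume y: "x \<le> y" "y \<le> 0"
      then have y1: "1 + y > 0" using assms by simp
      have "(?f has_real_derivative 1 - 2 * y / (2 * (1 + r)) - 1 / (1 + y)) (at y)"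
        using y1 r by (auto intro!: derivative_eq_intros)
      moreover have "1 - 2 * y / (2 * (1 + r)) - 1 / (1 + y) = y * (r - y) / ((1 + r) * (1 + y))"
        using y1 r by (simp add: divide_simps) (simp add: algebra_simps)
      moreover have "\<dots> \<le> 0" using y y1 r assms
        by (intro divide_nonpos_pos mult_nonpos_nonneg mult_pos_pos) auto
      ultimately show "\<exists>d. (?f has_real_derivative d) (at y) \<and> d \<le> 0" by metis
    qed
    then show ?thesis by simp
  qed
qed

section \<open>Factorisation of positive definite matrices and expansion of the
  log-determinant\<close>

text \<open>From \<open>A = P D P^T\<close> take \<open>L = P D^(1/2)\<close>. In contrast to a
  Cholesky factor, \<open>L^T L\<close> is then the diagonal matrix of eigenvalues, so comparisons
  with \<open>lambda_max A\<close> can be made entrywise.\<close>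

lemma pos_def_factor:
  assumes "pos_def_mat n A"
  obtains L d where "L \<in> carrier_mat n n" "A = L * transpose_mat L" "transpose_mat L * L = mat_diag n d"
    "\<And>i. i < n \<Longrightarrow> 0 < d i" "\<And>i. i < n \<Longrightarrow> d i \<le> lambda_max A"
proof -
  have A: "A \<in> carrier_mat n n" "transpose_mat A = A"
    and pos: "\<And>x. x \<in> carrier_vec n \<Longrightarrow> x \<noteq> 0\<^sub>v n \<Longrightarrow> x \<bullet> (A *\<^sub>v x) > 0"
    using assms by (auto simp: pos_def_mat_def)
  obtain P d where P: "P \<in> carrier_mat n n" "transpose_mat P * P = 1\<^sub>m n" "P * transpose_mat P = 1\<^sub>m n"
    and AP: "A = P * mat_diag n d * transpose_mat P"
    using spectral_theorem[OF A] by blast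
  note as = assoc_mult_mat[of _ n n _ n _ n]
  have ev: "eigenvalue A (d i)" and dpos: "d i > 0" if i: "i < n" for i
  proof -
    have c: "col P i \<in> carrier_vec n" by (rule carrier_vecI) (use P in auto)
    have "col P i \<bullet> col P i = (transpose_mat P * P) $$ (i, i)" using P(1) i by simp
    then have cc: "col P i \<bullet> col P i = 1" using i P by simp
    then have c0: "col P i \<noteq> 0\<^sub>v n" by auto
    have "A * P = P * mat_diag n d" unfolding AP using P by (simp add: as mult_carrier_mat[of _ n n _ n])
    then have "col (A * P) i = col (P * mat_diag n d) i" by simp
    also have "col (A * P) i = A *\<^sub>v col P i" using A P i by (intro col_mult2) auto
    also have "col (P * mat_diag n d) i = d i \<cdot>\<^sub>v col P i"
      using P i by (auto simp: mat_diag_mult_right[of _ n] intro!: eq_vecI)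
    finally have Ac: "A *\<^sub>v col P i = d i \<cdot>\<^sub>v col P i" .
    show "eigenvalue A (d i)" unfolding eigenvalue_def eigenvector_def using A c c0 Ac by auto
    show "d i > 0" using pos[OF c c0] Ac cc c by simp
  qed
  have fin: "finite {l. eigenvalue A l}"
  proof -
    have "char_poly A \<noteq> 0" using degree_monic_char_poly[OF A(1)] by auto
    then show ?thesis unfolding eigenvalue_root_char_poly[OF A(1)] by (rule poly_roots_finite)
  qed
  let ?L = "P * mat_diag n (\<lambda>i. sqrt (d i))"
  have Lt: "transpose_mat ?L = mat_diag n (\<lambda>i. sqrt (d i)) * transpose_mat P"
  proof -
    have "transpose_mat (mat_diag n (\<lambda>i. sqrt (d i))) = mat_diag n (\<lambda>i. sqrt (d i))"
      by (rule eq_matI) (auto simp: mat_diag_def)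
    then show ?thesis using P by (simp add: transpose_mult[of _ n n _ n])
  qed
  have sq: "mat_diag n (\<lambda>i. sqrt (d i)) * mat_diag n (\<lambda>i. sqrt (d i)) = mat_diag n d"
    unfolding mat_diag_diag by (rule eq_matI) (use dpos in \<open>auto simp: mat_diag_def less_imp_le\<close>)
  have c1: "mat_diag n (\<lambda>i. sqrt (d i)) * (mat_diag n (\<lambda>i. sqrt (d i)) * X) = mat_diag n d * X"
    if "X \<in> carrier_mat n n" for X
    using that sq by (simp flip: as)
  have c2: "transpose_mat P * (P * X) = X" if "X \<in> carrier_mat n n" for X
    using P that by (simp flip: as)
  show thesis
  proof (rule that[of ?L d])
    show "?L \<in> carrier_mat n n" using P by simp
    show "A = ?L * transpose_mat ?L" unfolding Lt AP using P by (simp add: as c1 mult_carrier_mat[of _ n n _ n] del: mat_diag_diag)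
    show "transpose_mat ?L * ?L = mat_diag n d" unfolding Lt using P by (simp add: as c2 sq mult_carrier_mat[of _ n n _ n] del: mat_diag_diag)
    fix i assume "i < n"
    then show "0 < d i" "d i \<le> lambda_max A"
      using dpos ev fin by (auto simp: lambda_max_def intro!: Max_ge)
  qed
qed

lemma pos_def_det_pos:
  assumes "pos_def_mat n A"
  shows "det A > 0"
proof -
  obtain L d where L: "L \<in> carrier_mat n n" "A = L * transpose_mat L" "transpose_mat L * L = mat_diag n d"
    "\<And>i. i < n \<Longrightarrow> 0 < d i"
    using pos_def_factor[OF assms] by metis
  have "det A = det (transpose_mat L * L)"
    using L(1) unfolding L(2) by (simp add: det_mult[of _ n] det_transpose)
  then show ?thesis using L by (auto simp: det_mat_diag intro: prod_pos)
qed

text \<open>\<open>R\<close> is the Frobenius norm of \<open>L\<^sup>-\<^sup>1 D L\<^sup>-\<^sup>T\<close>, where \<open>A = L L\<^sup>T\<close>.\<close>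

lemma log_det_second_order:
  assumes A: "pos_def_mat n A" and B: "pos_def_mat n (A + D)"
    and D: "D \<in> carrier_mat n n" "transpose_mat D = D"
    and S: "S \<in> carrier_mat n n" "A * S = 1\<^sub>m n"
  obtains R where "R \<ge> 0"
    "ln (det (A + D)) - ln (det A) - mat_trace (S * D) \<le> - R\<^sup>2 / (2 * (1 + R))"
    "(\<Sum>i<n. \<Sum>j<n. (D $$ (i, j))\<^sup>2) \<le> (lambda_max A * R)\<^sup>2"
proof -
  obtain L d where L: "L \<in> carrier_mat n n" and AL: "A = L * transpose_mat L"
    and LL: "transpose_mat L * L = mat_diag n d"
    and d: "\<And>i. i < n \<Longrightarrow> 0 < d i" "\<And>i. i < n \<Longrightarrow> d i \<le> lambda_max A"
    using pos_def_factor[OF A] by metis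
  note as = assoc_mult_mat[of _ n n _ n _ n]
  \<comment> \<open>\<open>K\<close> is the inverse of \<open>L\<close>, because
    \<open>L^T L\<close> is diagonal with positive entries.\<close>
  define K where "K = mat_diag n (\<lambda>i. 1 / d i) * transpose_mat L"
  have K: "K \<in> carrier_mat n n" using L by (simp add: K_def mult_carrier_mat[of _ n n])
  have KL: "K * L = 1\<^sub>m n"
  proof -
    have "K * L = mat_diag n (\<lambda>i. 1 / d i) * mat_diag n d"
      unfolding K_def using L by (simp add: as LL del: mat_diag_diag)
    also have "\<dots> = 1\<^sub>m n" unfolding mat_diag_diag by (rule eq_matI) (use d(1) in \<open>auto simp: mat_diag_def less_imp_neq[symmetric]\<close>)
    finally show ?thesis .
  qed
  have LK: "L * K = 1\<^sub>m n" using mat_mult_left_right_inverse[OF K L KL] .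
  have LtKt: "transpose_mat L * transpose_mat K = 1\<^sub>m n"
    using arg_cong[OF KL, of transpose_mat] K L by (simp add: transpose_mult[of _ n n _ n])
  have KtLt: "transpose_mat K * transpose_mat L = 1\<^sub>m n"
    using arg_cong[OF LK, of transpose_mat] K L by (simp add: transpose_mult[of _ n n _ n])
  have cK: "L * (K * X) = X" "K * (L * X) = X" "transpose_mat L * (transpose_mat K * X) = X"
      "transpose_mat K * (transpose_mat L * X) = X" if "X \<in> carrier_mat n n" for X
    using that L K LK KL LtKt KtLt by (simp_all flip: as)
  \<comment> \<open>Congruence by \<open>K\<close> turns \<open>A\<close> into the identity and
    \<open>A + D\<close> into \<open>1 + M\<close>, so only the eigenvalues of \<open>M\<close>
    matter; \<open>R\<close> will be their Euclidean norm.\<close>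
  define M where "M = K * D * transpose_mat K"
  have M: "M \<in> carrier_mat n n" using K D by (simp add: M_def)
  have Msym: "transpose_mat M = M"
    using K D by (simp add: M_def transpose_mult[of _ n n _ n] as)
  have DM: "D = L * M * transpose_mat L"
    using K L D by (simp add: M_def as cK KtLt)
  obtain \<mu> where det: "det (1\<^sub>m n + M) = (\<Prod>i<n. 1 + \<mu> i)"
    and tr: "mat_trace M = (\<Sum>i<n. \<mu> i)" and tr2: "mat_trace (M * M) = (\<Sum>i<n. (\<mu> i)\<^sup>2)"
    and ray: "\<And>i. i < n \<Longrightarrow> \<exists>x \<in> carrier_vec n. x \<bullet> x = 1 \<and> x \<bullet> (M *\<^sub>v x) = \<mu> i"
    using det_one_plus_symmetric_diagonalized[OF M Msym] by metis
  have M1: "1\<^sub>m n + M = K * (A + D) * transpose_mat K"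
    unfolding AL M_def using K L D
    by (simp add: mult_add_distrib_mat[of _ n n _ n] add_mult_distrib_mat[of _ n n _ _ n] as cK LtKt)
  \<comment> \<open>\<open>1 + \<mu> i\<close> is the value of the form of \<open>1 + M\<close> at a
    unit vector \<open>x\<close>, hence that of \<open>A + D\<close> at the nonzero vector
    \<open>K^T x\<close>.\<close>
  have mu: "1 + \<mu> i > 0" if i: "i < n" for i
  proof -
    obtain x where x: "x \<in> carrier_vec n" "x \<bullet> x = 1" "x \<bullet> (M *\<^sub>v x) = \<mu> i" using ray[OF i] by blast
    let ?y = "transpose_mat K *\<^sub>v x"
    have AD: "A + D \<in> carrier_mat n n" using B by (simp add: pos_def_mat_def)
    have y: "?y \<in> carrier_vec n" using K x by simp
    have "transpose_mat L *\<^sub>v ?y = x"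
      using K L x LtKt by (simp flip: assoc_mult_mat_vec[of _ n n _ n])
    moreover have "transpose_mat L *\<^sub>v 0\<^sub>v n = 0\<^sub>v n" using L by (intro eq_vecI) auto
    ultimately have "?y \<noteq> 0\<^sub>v n" using x by auto
    then have "0 < ?y \<bullet> ((A + D) *\<^sub>v ?y)" using B y unfolding pos_def_mat_def by blast
    also have "\<dots> = x \<bullet> (K *\<^sub>v ((A + D) *\<^sub>v ?y))"
      using K x AD y by (subst transpose_vec_mult_scalar[of K n n]) auto
    also have "K *\<^sub>v ((A + D) *\<^sub>v ?y) = (1\<^sub>m n + M) *\<^sub>v x"
      unfolding M1 using K AD x by (simp add: assoc_mult_mat_vec[of _ n n _ n])
    also have "x \<bullet> \<dots> = x \<bullet> x + x \<bullet> (M *\<^sub>v x)"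
      using M x by (simp add: add_mult_distrib_mat_vec[of _ n n] scalar_prod_add_distrib[of _ n])
    finally show ?thesis using x by simp
  qed
  define R where "R = sqrt (\<Sum>i<n. (\<mu> i)\<^sup>2)"
  have R0: "R \<ge> 0" by (simp add: R_def sum_nonneg)
  have R2: "R\<^sup>2 = (\<Sum>i<n. (\<mu> i)\<^sup>2)" by (simp add: R_def sum_nonneg)
  have muR: "\<bar>\<mu> i\<bar> \<le> R" if "i < n" for i
  proof -
    have "(\<mu> i)\<^sup>2 \<le> R\<^sup>2" unfolding R2 using that by (intro member_le_sum) auto
    then show ?thesis using R0 abs_le_square_iff[of "\<mu> i" R] by simp
  qed
  have detL: "det L \<noteq> 0" using arg_cong[OF LK, of det] L K by (auto simp: det_mult[of _ n])
  have detA: "det A = (det L)\<^sup>2" unfolding AL using L by (simp add: det_mult[of _ n] det_transpose power2_eq_square)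
  have "A + D = L * (1\<^sub>m n + M) * transpose_mat L"
    unfolding AL DM using L M
    by (simp add: mult_add_distrib_mat[of _ n n _ n] add_mult_distrib_mat[of _ n n _ _ n])
  then have "det (A + D) = (det L)\<^sup>2 * (\<Prod>i<n. 1 + \<mu> i)"
    using L M by (simp add: det_mult[of _ n] det_transpose det power2_eq_square)
  then have "ln (det (A + D)) = ln (det A) + (\<Sum>i<n. ln (1 + \<mu> i))"
    using detL prod_pos[of "{..<n}" "\<lambda>i. 1 + \<mu> i"] mu
      ln_prod[of "{..<n}" "\<lambda>i. 1 + \<mu> i", OF _ less_imp_neq[THEN not_sym]]
    by (simp add: detA ln_mult_pos)
  moreover have "mat_trace (S * D) = (\<Sum>i<n. \<mu> i)"
  proof -
    have A': "A \<in> carrier_mat n n" using A by (simp add: pos_def_mat_def)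
    have SA: "S * A = 1\<^sub>m n" using mat_mult_left_right_inverse[OF A' S] .
    \<comment> \<open>Since \<open>A = L L^T\<close>, its inverse is \<open>K^T K\<close>; cyclicity
      of the trace then gives \<open>tr (S D) = tr M\<close>.\<close>
    have "S = S * A * (transpose_mat K * K)"
      unfolding AL using S L K by (simp add: as cK LK)
    then have SK: "S = transpose_mat K * K" unfolding SA using K by simp
    have "mat_trace (S * D) = mat_trace (transpose_mat K * (K * D))" unfolding SK using K D by (simp add: as)
    also have "\<dots> = mat_trace (K * D * transpose_mat K)"
      using K D by (intro mat_trace_mult_commute) auto
    finally show ?thesis using tr by (simp add: M_def)
  qed
  \<comment> \<open>The logarithm bound is used with the common radius \<open>R\<close>, which
    dominates every \<open>\<bar>\<mu> i\<bar>\<close>.\<close>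
  moreover have "(\<Sum>i<n. ln (1 + \<mu> i)) \<le> (\<Sum>i<n. \<mu> i - (\<mu> i)\<^sup>2 / (2 * (1 + R)))"
    by (intro sum_mono ln_one_plus_le_quadratic) (use mu muR in force)+
  moreover have "\<dots> = (\<Sum>i<n. \<mu> i) - R\<^sup>2 / (2 * (1 + R))"
    unfolding R2 by (simp add: sum_subtractf sum_divide_distrib)
  ultimately have main: "ln (det (A + D)) - ln (det A) - mat_trace (S * D) \<le> - R\<^sup>2 / (2 * (1 + R))"
    by simp
  have symM: "M $$ (i, j) = M $$ (j, i)" if "i < n" "j < n" for i j
    using arg_cong[OF Msym, of "\<lambda>X. X $$ (i, j)"] that M by simp
  have symD: "D $$ (i, j) = D $$ (j, i)" if "i < n" "j < n" for i j
    using arg_cong[OF D(2), of "\<lambda>X. X $$ (i, j)"] that D(1) by simp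
  have "(\<Sum>i<n. \<Sum>j<n. (D $$ (i, j))\<^sup>2) = mat_trace (D * D)"
    using D symD by (auto simp: mat_trace_def scalar_prod_def power2_eq_square atLeast0LessThan intro!: sum.cong)
  \<comment> \<open>With \<open>D = L M L^T\<close> and the trace cycled, the squared entry
    \<open>(i, j)\<close> of \<open>M\<close> gets the weight \<open>d i * d j\<close>, at most the
    square of \<open>lambda_max A\<close>.\<close>
  also have "D * D = L * (M * (mat_diag n d * M) * transpose_mat L)"
  proof -
    have *: "transpose_mat L * (L * X) = mat_diag n d * X" if "X \<in> carrier_mat n n" for X
      using L that by (simp add: LL flip: as)
    show ?thesis unfolding DM using L M by (simp add: as * mult_carrier_mat[of _ n n])
  qed
  also have "mat_trace \<dots> = mat_trace (M * (mat_diag n d * M) * transpose_mat L * L)"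
    using L M by (intro mat_trace_mult_commute) (auto intro!: mult_carrier_mat)
  also have "M * (mat_diag n d * M) * transpose_mat L * L = M * (mat_diag n d * (M * mat_diag n d))"
    using L M by (simp add: as LL mult_carrier_mat[of _ n n])
  also have "mat_trace \<dots> = (\<Sum>i<n. \<Sum>j<n. d i * d j * (M $$ (i, j))\<^sup>2)"
    using M symM
    by (auto simp: mat_trace_def scalar_prod_def mat_diag_mult_right[of _ n n] mat_diag_mult_left[of _ n n]
        power2_eq_square atLeast0LessThan intro!: sum.cong)
  also have "\<dots> \<le> (\<Sum>i<n. \<Sum>j<n. lambda_max A * lambda_max A * (M $$ (i, j))\<^sup>2)"
    using d by (intro sum_mono mult_right_mono mult_mono)
      (auto intro: less_imp_le order.trans[OF less_imp_le[OF d(1)] d(2)])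
  also have "\<dots> = (lambda_max A)\<^sup>2 * mat_trace (M * M)"
    using M symM by (auto simp: mat_trace_def scalar_prod_def power2_eq_square atLeast0LessThan
        sum_distrib_left intro!: sum.cong)
  finally have "(\<Sum>i<n. \<Sum>j<n. (D $$ (i, j))\<^sup>2) \<le> (lambda_max A * R)\<^sup>2"
    by (simp add: tr2 R2 power_mult_distrib)
  with R0 main show thesis by (rule that)
qed

section \<open>Schur complements and Gaussian integrals\<close>

text \<open>Right multiplication by a unit lower block-triangular matrix clears \<open>C\<close>
  without changing the determinant.\<close>

lemma det_four_block_mat_schur_lower:
  fixes A :: "'a :: idom mat"
  assumes A: "A \<in> carrier_mat n n" and B: "B \<in> carrier_mat n m" and C: "C \<in> carrier_mat m n"
    and D: "D \<in> carrier_mat m m" and Di: "Di \<in> carrier_mat m m" "D * Di = 1\<^sub>m m"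
  shows "det (four_block_mat A B C D) = det D * det (A - B * Di * C)"
proof -
  let ?N = "four_block_mat (1\<^sub>m n) (0\<^sub>m n m) (- (Di * C)) (1\<^sub>m m)"
  have N: "det ?N = 1"
    using Di C by (subst det_four_block_mat_upper_right_zero[of _ n _ m]) auto
  have "D * (Di * C) = C"
    using D C Di by (simp flip: assoc_mult_mat[of _ m m _ m _ n])
  then have DC: "C + - (D * (Di * C)) = 0\<^sub>m m n"
    using C add_uminus_minus_mat[OF C C] minus_r_inv_mat[OF C] by simp
  have BC: "A + - (B * (Di * C)) = A - B * (Di * C)"
    using A B C Di by (intro add_uminus_minus_mat[of _ n n]) auto
  have "four_block_mat A B C D * ?N = four_block_mat (A - B * Di * C) B (0\<^sub>m m n) D"
    using A B C D Di
    by (subst mult_four_block_mat[of _ n n _ m _ m _ _ n _ m]) (auto simp: DC BC)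
  then have "det (four_block_mat A B C D) * det ?N = det (four_block_mat (A - B * Di * C) B (0\<^sub>m m n) D)"
    using A B C D Di by (subst det_mult[symmetric, of _ "n + m"]) auto
  also have "\<dots> = det (A - B * Di * C) * det D"
    using A B C D Di by (intro det_four_block_mat_lower_left_zero[of _ n _ m]) auto
  finally show ?thesis using N by (simp add: mult.commute)
qed

text \<open>The mirror image: here the multiplier is upper block-triangular and clears
  \<open>B\<close>.\<close>

lemma det_four_block_mat_schur_upper:
  fixes A :: "'a :: idom mat"
  assumes A: "A \<in> carrier_mat n n" and B: "B \<in> carrier_mat n m" and C: "C \<in> carrier_mat m n"
    and D: "D \<in> carrier_mat m m" and Ai: "Ai \<in> carrier_mat n n" "A * Ai = 1\<^sub>m n"
  shows "det (four_block_mat A B C D) = det A * det (D - C * Ai * B)"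
proof -
  let ?N = "four_block_mat (1\<^sub>m n) (- (Ai * B)) (0\<^sub>m m n) (1\<^sub>m m)"
  have N: "det ?N = 1"
    using Ai B by (subst det_four_block_mat_lower_left_zero[of _ n _ m]) auto
  have "A * (Ai * B) = B"
    using A B Ai by (simp flip: assoc_mult_mat[of _ n n _ n _ m])
  then have AB: "- (A * (Ai * B)) + B = 0\<^sub>m n m" using B by (simp add: uminus_l_inv_mat[OF B])
  have CB: "- (C * (Ai * B)) + D = D - C * (Ai * B)"
    using B C D Ai by (intro eq_matI) (auto simp del: index_mult_mat(1) intro!: mult_carrier_mat)
  have "four_block_mat A B C D * ?N = four_block_mat A (0\<^sub>m n m) C (D - C * Ai * B)"
    using A B C D Ai
    by (subst mult_four_block_mat[of _ n n _ m _ m _ _ n _ m]) (auto simp: AB CB)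
  then have "det (four_block_mat A B C D) * det ?N = det (four_block_mat A (0\<^sub>m n m) C (D - C * Ai * B))"
    using A B C D Ai by (subst det_mult[symmetric, of _ "n + m"]) auto
  also have "\<dots> = det A * det (D - C * Ai * B)"
    using A B C D Ai by (intro det_four_block_mat_upper_right_zero[of _ n _ m]) auto
  finally show ?thesis using N by simp
qed

text \<open>The matrix determinant lemma: the matrix \<open>A\<close> bordered by the column
  \<open>u\<close>, the row \<open>t u^T\<close> and the corner 1 is evaluated by both Schur
  complements.\<close>

lemma det_rank_one_update:
  fixes A :: "real mat"
  assumes A: "A \<in> carrier_mat n n" and S: "S \<in> carrier_mat n n" "A * S = 1\<^sub>m n"
    and u: "u \<in> carrier_vec n"
  shows "det (A - mat n n (\<lambda>(i, j). t * u $ i * u $ j)) = det A * (1 - t * (u \<bullet> (S *\<^sub>v u)))"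
proof -
  let ?U = "mat n 1 (\<lambda>(i, j). u $ i)" and ?V = "mat 1 n (\<lambda>(i, j). t * u $ j)"
  have "?U * 1\<^sub>m 1 * ?V = mat n n (\<lambda>(i, j). t * u $ i * u $ j)"
    by (rule eq_matI) (auto simp: scalar_prod_def)
  moreover have "det (1\<^sub>m 1 - ?V * S * ?U) = 1 - t * (u \<bullet> (S *\<^sub>v u))"
  proof -
    have "(?V * S * ?U) $$ (0, 0) = (\<Sum>k = 0..<n. (\<Sum>l = 0..<n. t * u $ l * S $$ (l, k)) * u $ k)"
      using S u by (simp add: scalar_prod_def)
    also have "\<dots> = (\<Sum>k = 0..<n. \<Sum>l = 0..<n. t * (u $ l * (S $$ (l, k) * u $ k)))"
      by (simp add: sum_distrib_right mult.assoc)
    also have "\<dots> = (\<Sum>l = 0..<n. \<Sum>k = 0..<n. t * (u $ l * (S $$ (l, k) * u $ k)))"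
      by (rule sum.swap)
    also have "\<dots> = t * (u \<bullet> (S *\<^sub>v u))"
      using S u by (simp add: scalar_prod_def sum_distrib_left)
    finally show ?thesis by (subst det_single) (auto simp: scalar_prod_def)
  qed
  moreover have "det (four_block_mat A ?U ?V (1\<^sub>m 1)) = det (1\<^sub>m 1 :: real mat) * det (A - ?U * 1\<^sub>m 1 * ?V)"
    using A by (intro det_four_block_mat_schur_lower) auto
  moreover have "det (four_block_mat A ?U ?V (1\<^sub>m 1)) = det A * det (1\<^sub>m 1 - ?V * S * ?U)"
    using A S by (intro det_four_block_mat_schur_upper) auto
  ultimately show ?thesis by simp
qed

section \<open>Quadratic forms and the Gaussian normalising constant\<close>

text \<open>The argument is a function and not a \<open>vec\<close>, because the points of the
  product measure \<open>PiM {..<p}\<close> are functions.\<close>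

definition quad_form :: "nat \<Rightarrow> real mat \<Rightarrow> (nat \<Rightarrow> real) \<Rightarrow> real" where
  "quad_form p A x = (\<Sum>i<p. \<Sum>j<p. A $$ (i, j) * x i * x j)"

lemma scalar_prod_mult_mat_vec_eq_quad_form:
  "A \<in> carrier_mat p p \<Longrightarrow> v \<in> carrier_vec p \<Longrightarrow> v \<bullet> (A *\<^sub>v v) = quad_form p A (($) v)"
  by (auto simp: quad_form_def scalar_prod_def atLeast0LessThan sum_distrib_left algebra_simps intro!: sum.cong)

lemma scalar_prod_vec_eq_quad_form:
  "A \<in> carrier_mat p p \<Longrightarrow> vec p x \<bullet> (A *\<^sub>v vec p x) = quad_form p A x"
  by (subst scalar_prod_mult_mat_vec_eq_quad_form) (auto simp: quad_form_def)

lemma measurable_quad_form [measurable]: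
  "quad_form p A \<in> borel_measurable (PiM {..<p} (\<lambda>_. lborel))"
  unfolding quad_form_def[abs_def] by measurable

lemma pos_def_mat_quad_form:
  "pos_def_mat p A \<longleftrightarrow> A \<in> carrier_mat p p \<and> transpose_mat A = A \<and>
     (\<forall>x. (\<exists>i<p. x i \<noteq> 0) \<longrightarrow> quad_form p A x > 0)"
proof -
  have "(\<forall>x \<in> carrier_vec p. x \<noteq> 0\<^sub>v p \<longrightarrow> x \<bullet> (A *\<^sub>v x) > 0) \<longleftrightarrow>
        (\<forall>x. (\<exists>i<p. x i \<noteq> 0) \<longrightarrow> quad_form p A x > 0)" (is "?l \<longleftrightarrow> ?r")
    if A: "A \<in> carrier_mat p p"
  proof safe
    fix x :: "nat \<Rightarrow> real" and i
    assume l: ?l and i: "i < p" "x i \<noteq> 0"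
    have "vec p x \<noteq> 0\<^sub>v p"
      using i by (metis index_vec index_zero_vec(1))
    then show "quad_form p A x > 0"
      using l A by (auto simp flip: scalar_prod_vec_eq_quad_form)
  next
    fix v :: "real vec"
    assume r: ?r and v: "v \<in> carrier_vec p" "v \<noteq> 0\<^sub>v p"
    then have "\<exists>i<p. v $ i \<noteq> 0" by (auto intro!: eq_vecI)
    then show "v \<bullet> (A *\<^sub>v v) > 0"
      using r A v by (auto simp: scalar_prod_mult_mat_vec_eq_quad_form)
  qed
  then show ?thesis unfolding pos_def_mat_def by blast
qed

text \<open>The integrand is a multiple of the normal density with mean \<open>m\<close> and
  standard deviation \<open>1 / sqrt a\<close>.\<close>

lemma nn_integral_gaussian_quadratic:
  fixes a m :: real
  assumes "a > 0"
  shows "(\<integral>\<^sup>+ y. ennreal (exp (- (a * (y - m)\<^sup>2) / 2)) \<partial>lborel) = ennreal (sqrt (2 * pi / a))"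
proof -
  have "exp (- (a * (y - m)\<^sup>2) / 2) = sqrt (2 * pi / a) * normal_density m (1 / sqrt a) y" for y
    using assms by (simp add: normal_density_def power_divide real_sqrt_divide field_simps)
  then have "(\<integral>\<^sup>+ y. ennreal (exp (- (a * (y - m)\<^sup>2) / 2)) \<partial>lborel)
      = (\<integral>\<^sup>+ y. ennreal (sqrt (2 * pi / a)) * ennreal (normal_density m (1 / sqrt a) y) \<partial>lborel)"
    using assms by (intro nn_integral_cong) (simp add: ennreal_mult')
  also have "\<dots> = ennreal (sqrt (2 * pi / a)) * (\<integral>\<^sup>+ y. ennreal (normal_density m (1 / sqrt a) y) \<partial>lborel)"
    by (intro nn_integral_cmult) auto
  also have "(\<integral>\<^sup>+ y. ennreal (normal_density m (1 / sqrt a) y) \<partial>lborel) = 1"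
    using assms by (subst nn_integral_eq_integral) (auto simp: normal_density_nonneg)
  finally show ?thesis by simp
qed

text \<open>Induction on the dimension, integrating out the last coordinate: completing the square
  leaves a one-dimensional Gaussian and the form of a Schur complement, and the determinant factors
  in the same way.\<close>

lemma nn_integral_exp_quad_form:
  assumes "pos_def_mat p A"
  shows "det A > 0 \<and> (\<integral>\<^sup>+ x. ennreal (exp (- quad_form p A x / 2)) \<partial>PiM {..<p} (\<lambda>_. lborel))
           = ennreal ((2 * pi) powr (real p / 2) / sqrt (det A))"
  using assms
proof (induction p arbitrary: A)
  case 0
  then show ?case by (auto simp: pos_def_mat_def quad_form_def nn_integral_empty PiM_empty)
next
  case (Suc p)
  interpret product_sigma_finite "\<lambda>_::nat. lborel :: real measure" ..
  have A: "A \<in> carrier_mat (Suc p) (Suc p)" and sym: "transpose_mat A = A"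
    and pos: "\<And>x. \<exists>i<Suc p. x i \<noteq> 0 \<Longrightarrow> quad_form (Suc p) A x > 0"
    using Suc.prems by (auto simp: pos_def_mat_quad_form)
  have As: "A $$ (i, j) = A $$ (j, i)" if "i < Suc p" "j < Suc p" for i j
    using arg_cong[OF sym, of "\<lambda>M. M $$ (i, j)"] that A by simp
  then have Ap: "A $$ (p, j) = A $$ (j, p)" if "j < p" for j using that by simp
  define a where "a = A $$ (p, p)"
  define s where "s x = (\<Sum>i<p. A $$ (i, p) * x i)" for x :: "nat \<Rightarrow> real"
  \<comment> \<open>The Schur complement of the corner entry \<open>a\<close>.\<close>
  define A' where "A' = mat p p (\<lambda>(i, j). A $$ (i, j) - A $$ (i, p) * A $$ (p, j) / a)"
  have A': "A' \<in> carrier_mat p p" by (simp add: A'_def)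
  have "quad_form (Suc p) A (\<lambda>i. if i = p then 1 else 0) > 0" by (rule pos) auto
  also have "quad_form (Suc p) A (\<lambda>i. if i = p then 1 else 0) = a"
    by (simp add: quad_form_def a_def)
  finally have a: "a > 0" .
  have split: "quad_form (Suc p) A (x(p := y)) = a * (y - (- s x / a))\<^sup>2 + quad_form p A' x" for x y
  proof -
    have "quad_form (Suc p) A (x(p := y))
        = (\<Sum>i<p. \<Sum>j<p. A $$ (i, j) * x i * x j) + 2 * y * s x + a * y\<^sup>2"
      by (simp add: quad_form_def s_def sum.distrib a_def power2_eq_square Ap
          sum_distrib_left algebra_simps)
    also have "(\<Sum>i<p. \<Sum>j<p. A $$ (i, j) * x i * x j) = quad_form p A' x + (s x)\<^sup>2 / a"
    proof -
      have "(s x)\<^sup>2 / a = (\<Sum>i<p. \<Sum>j<p. A $$ (i, p) * x i * (A $$ (p, j) * x j) / a)"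
        by (simp add: s_def power2_eq_square sum_product sum_divide_distrib Ap)
      then show ?thesis
        by (simp add: quad_form_def A'_def algebra_simps flip: sum.distrib)
    qed
    also have "quad_form p A' x + (s x)\<^sup>2 / a + 2 * y * s x + a * y\<^sup>2
        = a * (y - (- s x / a))\<^sup>2 + quad_form p A' x"
      using a by (simp add: power2_eq_square field_simps)
    finally show ?thesis .
  qed
  have pd: "pos_def_mat p A'"
    unfolding pos_def_mat_quad_form
  proof (intro conjI allI impI A')
    show "transpose_mat A' = A'" by (rule eq_matI) (auto simp: A'_def Ap As)
    fix x :: "nat \<Rightarrow> real" assume "\<exists>i<p. x i \<noteq> 0"
    \<comment> \<open>Extending \<open>x\<close> by \<open>- s x / a\<close> makes the square
      vanish, so positivity of \<open>A\<close> passes to \<open>A'\<close>.\<close>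
    then have "\<exists>i<Suc p. (x(p := - s x / a)) i \<noteq> 0" by (metis fun_upd_apply less_Suc_eq less_irrefl)
    from pos[OF this] show "quad_form p A' x > 0" unfolding split by simp
  qed
  note IH = Suc.IH[OF pd]
  let ?B = "mat p 1 (\<lambda>(i, j). A $$ (i, p))" and ?C = "mat 1 p (\<lambda>(i, j). A $$ (p, j))"
    and ?A1 = "mat p p (\<lambda>(i, j). A $$ (i, j))" and ?D = "mat 1 1 (\<lambda>_. a)"
  have "det A = det (four_block_mat ?A1 ?B ?C ?D)"
    using A by (intro arg_cong[of _ _ det] eq_matI) (auto simp: a_def less_Suc_eq)
  also have "\<dots> = det ?D * det (?A1 - ?B * mat 1 1 (\<lambda>_. 1 / a) * ?C)"
    using a by (intro det_four_block_mat_schur_lower) (auto simp: scalar_prod_def intro!: eq_matI)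
  also have "?A1 - ?B * mat 1 1 (\<lambda>_. 1 / a) * ?C = A'"
    by (rule eq_matI) (auto simp: A'_def scalar_prod_def)
  also have "det ?D = a" by (subst det_single) auto
  finally have detA: "det A = a * det A'" .
  have "(\<integral>\<^sup>+ x. ennreal (exp (- quad_form (Suc p) A x / 2)) \<partial>PiM {..<Suc p} (\<lambda>_. lborel))
      = (\<integral>\<^sup>+ x. \<integral>\<^sup>+ y. ennreal (exp (- quad_form (Suc p) A (x(p := y)) / 2)) \<partial>lborel \<partial>PiM {..<p} (\<lambda>_. lborel))"
    unfolding lessThan_Suc
    by (subst product_nn_integral_insert) (auto simp flip: lessThan_Suc)
  also have "\<dots> = (\<integral>\<^sup>+ x. ennreal (exp (- quad_form p A' x / 2)) * ennreal (sqrt (2 * pi / a)) \<partial>PiM {..<p} (\<lambda>_. lborel))"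
  proof (rule nn_integral_cong)
    fix x :: "nat \<Rightarrow> real"
    have "(\<integral>\<^sup>+ y. ennreal (exp (- quad_form (Suc p) A (x(p := y)) / 2)) \<partial>lborel)
      = (\<integral>\<^sup>+ y. ennreal (exp (- quad_form p A' x / 2)) * ennreal (exp (- (a * (y - (- s x / a))\<^sup>2) / 2)) \<partial>lborel)"
      unfolding split by (intro nn_integral_cong) (simp add: ennreal_mult[symmetric] exp_add[symmetric] add_divide_distrib diff_divide_distrib)
    also have "\<dots> = ennreal (exp (- quad_form p A' x / 2)) * (\<integral>\<^sup>+ y. ennreal (exp (- (a * (y - (- s x / a))\<^sup>2) / 2)) \<partial>lborel)"
      by (rule nn_integral_cmult) simp
    also have "\<dots> = ennreal (exp (- quad_form p A' x / 2)) * ennreal (sqrt (2 * pi / a))"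
      by (subst nn_integral_gaussian_quadratic[OF a]) simp
    finally show "(\<integral>\<^sup>+ y. ennreal (exp (- quad_form (Suc p) A (x(p := y)) / 2)) \<partial>lborel)
      = ennreal (exp (- quad_form p A' x / 2)) * ennreal (sqrt (2 * pi / a))" .
  qed
  also have "\<dots> = ennreal ((2 * pi) powr (real p / 2) / sqrt (det A')) * ennreal (sqrt (2 * pi / a))"
    using IH by (subst nn_integral_multc) auto
  also have "\<dots> = ennreal ((2 * pi) powr (real p / 2) / sqrt (det A') * sqrt (2 * pi / a))"
    using a by (subst ennreal_mult''[symmetric]) auto
  also have "(2 * pi) powr (real p / 2) / sqrt (det A') * sqrt (2 * pi / a) = (2 * pi) powr (real (Suc p) / 2) / sqrt (det A)"
    using a by (simp add: detA real_sqrt_mult real_sqrt_divide add_divide_distrib powr_add powr_half_sqrt mult_ac)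
  finally show ?case using IH a detA by simp
qed

section \<open>Concentration of the sample covariance\<close>

lemma pos_def_inverse:
  assumes A: "pos_def_mat p A" and S: "S \<in> carrier_mat p p" "A * S = 1\<^sub>m p"
  shows "transpose_mat S = S"
proof -
  have A': "A \<in> carrier_mat p p" "transpose_mat A = A" using A by (auto simp: pos_def_mat_def)
  have "transpose_mat S * A = 1\<^sub>m p"
    using arg_cong[OF S(2), of transpose_mat] A' S(1) by (simp add: transpose_mult[of _ p p _ p])
  then have "transpose_mat S * A * S = S" using S by simp
  then show ?thesis using A' S by (simp add: assoc_mult_mat[of _ p p _ p _ p])
qed

definition lin_form :: "nat \<Rightarrow> (nat \<Rightarrow> real) \<Rightarrow> (nat \<Rightarrow> real) \<Rightarrow> real" where
  "lin_form p u x = (\<Sum>i<p. u i * x i)"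

lemma measurable_lin_form [measurable]:
  "lin_form p u \<in> borel_measurable (PiM {..<p} (\<lambda>_. lborel))"
  unfolding lin_form_def[abs_def] by measurable

lemma lin_form_eq_scalar_prod: "lin_form p u x = vec p u \<bullet> vec p x"
  by (simp add: lin_form_def scalar_prod_def atLeast0LessThan)

text \<open>Cauchy-Schwarz for the inner product defined by \<open>A\<close>: with
  \<open>W = S u\<close>, the linear form is the product of \<open>W\<close> and \<open>x\<close>,
  and \<open>quad_form p S u\<close> is the squared length of \<open>W\<close>.\<close>

lemma pos_def_cauchy_schwarz:
  assumes A: "pos_def_mat p A" and S: "S \<in> carrier_mat p p" "A * S = 1\<^sub>m p"
  shows "0 \<le> quad_form p S u" "(lin_form p u x)\<^sup>2 \<le> quad_form p S u * quad_form p A x"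
proof -
  have A': "A \<in> carrier_mat p p" and sym: "transpose_mat A = A" using A by (auto simp: pos_def_mat_def)
  have nonneg: "Y \<bullet> (A *\<^sub>v Y) \<ge> 0" if "Y \<in> carrier_vec p" for Y
    using A that A' by (cases "Y = 0\<^sub>v p") (auto simp: pos_def_mat_def less_imp_le intro!: mult_mat_vec_carrier)
  define U where "U = vec p u"
  define X where "X = vec p x"
  define W where "W = S *\<^sub>v U"
  have car: "U \<in> carrier_vec p" "X \<in> carrier_vec p" "W \<in> carrier_vec p"
    using S by (auto simp: U_def X_def W_def intro!: mult_mat_vec_carrier[of _ p p])
  have AW: "A *\<^sub>v W = U"
    using A' S car(1) by (simp add: W_def flip: assoc_mult_mat_vec[of _ p p _ p])
  have v: "quad_form p S u = W \<bullet> U"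
    using S car scalar_prod_vec_eq_quad_form[OF S(1), of u] comm_scalar_prod[of U p W]
    by (simp add: W_def U_def)
  have "W \<bullet> U = W \<bullet> (A *\<^sub>v W)" by (simp add: AW)
  then show v0: "0 \<le> quad_form p S u" using nonneg[OF car(3)] v by simp
  have l: "lin_form p u x = U \<bullet> X" by (simp add: lin_form_eq_scalar_prod U_def X_def)
  have q: "quad_form p A x = X \<bullet> (A *\<^sub>v X)" using scalar_prod_vec_eq_quad_form[OF A'] by (simp add: X_def)
  have WAX: "W \<bullet> (A *\<^sub>v X) = U \<bullet> X"
    using transpose_vec_mult_scalar[OF A' car(2,3)] sym AW by simp
  have AX: "A *\<^sub>v X \<in> carrier_vec p" using A' car by simp
  \<comment> \<open>The form of \<open>A\<close> at \<open>X + c W\<close> is nonnegative; as a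
    quadratic in \<open>c\<close> it is used below at its minimiser.\<close>
  have key: "0 \<le> quad_form p A x + 2 * c * lin_form p u x + c\<^sup>2 * quad_form p S u" for c
  proof -
    have "0 \<le> (X + c \<cdot>\<^sub>v W) \<bullet> (A *\<^sub>v (X + c \<cdot>\<^sub>v W))" using car by (intro nonneg) auto
    also have "A *\<^sub>v (X + c \<cdot>\<^sub>v W) = A *\<^sub>v X + c \<cdot>\<^sub>v U"
      using A' car AW by (simp add: mult_add_distrib_mat_vec[of _ p p] mult_mat_vec[of _ p p])
    also have "(X + c \<cdot>\<^sub>v W) \<bullet> (A *\<^sub>v X + c \<cdot>\<^sub>v U)
        = X \<bullet> (A *\<^sub>v X) + c * (X \<bullet> U) + (c * (W \<bullet> (A *\<^sub>v X)) + c * (c * (W \<bullet> U)))"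
      using car AX by (simp add: add_scalar_prod_distrib[of _ p] scalar_prod_add_distrib[of _ p] distrib_left)
    also have "X \<bullet> U = U \<bullet> X" using car by (simp add: comm_scalar_prod[of _ p])
    finally show ?thesis by (simp add: WAX l q v power2_eq_square)
  qed
  show "(lin_form p u x)\<^sup>2 \<le> quad_form p S u * quad_form p A x"
  proof (cases "quad_form p S u = 0")
    case True
    \<comment> \<open>Here the minimiser would divide by zero. Definiteness gives
      \<open>W = 0\<close>, thus \<open>U = A W = 0\<close>, and the linear form vanishes.\<close>
    have "W = 0\<^sub>v p"
    proof (rule ccontr)
      assume "W \<noteq> 0\<^sub>v p"
      then have "W \<bullet> (A *\<^sub>v W) > 0" using A car unfolding pos_def_mat_def by blast
      then show False using True v AW by simp
    qed
    then have "U = 0\<^sub>v p" using AW A' by (auto intro!: eq_vecI)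
    then show ?thesis using True car l by simp
  next
    case False
    then have pos: "quad_form p S u > 0" using v0 by simp
    show ?thesis
      using key[of "- lin_form p u x / quad_form p S u"] pos
      by (simp add: power2_eq_square field_simps)
  qed
qed

lemma quad_form_minus_rank_one:
  assumes "A \<in> carrier_mat p p"
  shows "quad_form p (A - mat p p (\<lambda>(i, j). t * vec p u $ i * vec p u $ j)) x
    = quad_form p A x - t * (lin_form p u x)\<^sup>2"
  using assms by (simp add: quad_form_def lin_form_def power2_eq_square sum_product sum_distrib_left
      algebra_simps flip: sum_subtractf)

lemma gauss_density_eq:
  "A \<in> carrier_mat p p \<Longrightarrow>
    gauss_density p A x = (2 * pi) powr (- real p / 2) * sqrt (det A) * exp (- quad_form p A x / 2)"
  by (simp add: gauss_density_def scalar_prod_vec_eq_quad_form)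

lemma sets_gauss_vec [measurable_cong, simp]: "sets (gauss_vec p A) = sets (PiM {..<p} (\<lambda>_. lborel))"
  by (simp add: gauss_vec_def)

lemma space_gauss_vec [simp]: "space (gauss_vec p A) = space (PiM {..<p} (\<lambda>_. lborel))"
  by (simp add: gauss_vec_def)

text \<open>Tilting the density by the exponential gives an unnormalised Gaussian with precision
  matrix \<open>B = A - t u u^T\<close>, so the integral is a quotient of normalising constants,
  evaluated by the rank-one determinant formula.\<close>

lemma nn_integral_exp_square_gauss_vec:
  assumes A: "pos_def_mat p A" and S: "S \<in> carrier_mat p p" "A * S = 1\<^sub>m p"
    and t: "t * quad_form p S u < 1"
  shows "(\<integral>\<^sup>+ x. ennreal (exp (t * (lin_form p u x)\<^sup>2 / 2)) \<partial>gauss_vec p A)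
    = ennreal (1 / sqrt (1 - t * quad_form p S u))"
proof -
  have A': "A \<in> carrier_mat p p" "transpose_mat A = A"
    and pos: "\<And>x. \<exists>i<p. x i \<noteq> 0 \<Longrightarrow> quad_form p A x > 0"
    using A by (auto simp: pos_def_mat_quad_form)
  define B where "B = A - mat p p (\<lambda>(i, j). t * vec p u $ i * vec p u $ j)"
  have B: "B \<in> carrier_mat p p" using A' by (simp add: B_def minus_carrier_mat)
  have qB: "quad_form p B x = quad_form p A x - t * (lin_form p u x)\<^sup>2" for x
    unfolding B_def by (rule quad_form_minus_rank_one[OF A'(1)])
  have As: "A $$ (i, j) = A $$ (j, i)" if "i < p" "j < p" for i j
    using arg_cong[OF A'(2), of "\<lambda>M. M $$ (i, j)"] that A'(1) by simp
  have pdB: "pos_def_mat p B"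
    unfolding pos_def_mat_quad_form
  proof (intro conjI allI impI B)
    show "transpose_mat B = B"
      by (rule eq_matI) (use A'(1) As in \<open>auto simp: B_def\<close>)
    fix x :: "nat \<Rightarrow> real" assume "\<exists>i<p. x i \<noteq> 0"
    then have q: "quad_form p A x > 0" by (rule pos)
    show "quad_form p B x > 0"
    proof (cases "t \<le> 0")
      case True
      then have "t * (lin_form p u x)\<^sup>2 \<le> 0" by (simp add: mult_nonpos_nonneg)
      then show ?thesis using q by (simp add: qB)
    next
      case False
      \<comment> \<open>For positive \<open>t\<close>, Cauchy-Schwarz and
        \<open>t * quad_form p S u < 1\<close> keep \<open>B\<close> positive definite.\<close>
      then have "t * (lin_form p u x)\<^sup>2 \<le> t * (quad_form p S u * quad_form p A x)"
        using pos_def_cauchy_schwarz(2)[OF A S] by (intro mult_left_mono) auto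
      also have "\<dots> < 1 * quad_form p A x" unfolding mult.assoc[symmetric] using q t by (intro mult_strict_right_mono) auto
      finally show ?thesis by (simp add: qB)
    qed
  qed
  have detB: "det B = det A * (1 - t * quad_form p S u)"
    unfolding B_def using det_rank_one_update[OF A'(1) S, of "vec p u" t]
    by (simp add: scalar_prod_vec_eq_quad_form[OF S(1)])
  note gB = nn_integral_exp_quad_form[OF pdB] and gA = nn_integral_exp_quad_form[OF A]
  let ?c = "(2 * pi) powr (- real p / 2) * sqrt (det A)"
  have "(\<integral>\<^sup>+ x. ennreal (exp (t * (lin_form p u x)\<^sup>2 / 2)) \<partial>gauss_vec p A)
    = (\<integral>\<^sup>+ x. ennreal (gauss_density p A x) * ennreal (exp (t * (lin_form p u x)\<^sup>2 / 2)) \<partial>PiM {..<p} (\<lambda>_. lborel))"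
    unfolding gauss_vec_def
    by (rule nn_integral_density) (simp_all add: gauss_density_eq[OF A'(1)])
  also have "\<dots> = (\<integral>\<^sup>+ x. ennreal ?c * ennreal (exp (- quad_form p B x / 2)) \<partial>PiM {..<p} (\<lambda>_. lborel))"
    using gA by (intro nn_integral_cong)
      (simp add: gauss_density_eq[OF A'(1)] qB ennreal_mult[symmetric] exp_add[symmetric] mult.assoc
        diff_divide_distrib)
  also have "\<dots> = ennreal ?c * ennreal ((2 * pi) powr (real p / 2) / sqrt (det B))"
    using gB by (subst nn_integral_cmult) auto
  also have "\<dots> = ennreal (?c * ((2 * pi) powr (real p / 2) / sqrt (det B)))"
    using gA by (subst ennreal_mult'[symmetric]) auto
  also have "?c * ((2 * pi) powr (real p / 2) / sqrt (det B)) = 1 / sqrt (1 - t * quad_form p S u)"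
  proof -
    have "(2 * pi) powr (- real p / 2) * (2 * pi) powr (real p / 2) = 1"
      by (simp flip: powr_add)
    then have "?c * ((2 * pi) powr (real p / 2) / sqrt (det B)) = sqrt (det A) / sqrt (det B)"
      by (simp add: field_simps)
    also have "\<dots> = 1 / sqrt (1 - t * quad_form p S u)"
      using gA t by (simp add: detB real_sqrt_mult)
    finally show ?thesis .
  qed
  finally show ?thesis .
qed

lemma pos_def_mat_inverse_exists:
  assumes "pos_def_mat p A"
  obtains S where "S \<in> carrier_mat p p" "A * S = 1\<^sub>m p"
proof -
  have A: "A \<in> carrier_mat p p" using assms by (simp add: pos_def_mat_def)
  show thesis
    using that det_non_zero_imp_unit[OF A, of undefined] pos_def_det_pos[OF assms]
    by (auto simp: Units_def ring_mat_simps)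
qed

text \<open>Total mass one is the case \<open>t = 0\<close> of the moment generating
  function.\<close>

lemma prob_space_gauss_vec:
  assumes A: "pos_def_mat p A"
  shows "prob_space (gauss_vec p A)"
proof
  obtain S where S: "S \<in> carrier_mat p p" "A * S = 1\<^sub>m p" using pos_def_mat_inverse_exists[OF A] .
  show "emeasure (gauss_vec p A) (space (gauss_vec p A)) = 1"
    using nn_integral_exp_square_gauss_vec[OF A S, of 0 "\<lambda>_. 0"] by simp
qed

lemma prob_space_sample_law:
  "pos_def_mat p A \<Longrightarrow> prob_space (sample_law n p A)"
  unfolding sample_law_def by (intro prob_space_PiM prob_space_gauss_vec)

lemma measurable_sample_entry:
  assumes "i < n" "j < p"
  shows "(\<lambda>X. X i j) \<in> borel_measurable (sample_law n p A)"
  unfolding sample_law_def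
proof (rule measurable_compose[OF measurable_component_singleton])
  show "(\<lambda>x. x j) \<in> borel_measurable (gauss_vec p A)"
    using measurable_component_singleton[of j "{..<p}" "\<lambda>_. lborel :: real measure"] assms by simp
qed (use assms in simp)

lemma measurable_sample_lin_form:
  assumes "i < n"
  shows "(\<lambda>X. lin_form p u (X i)) \<in> borel_measurable (sample_law n p A)"
  unfolding sample_law_def
proof (rule measurable_compose[OF measurable_component_singleton])
  show "lin_form p u \<in> borel_measurable (gauss_vec p A)"
    using measurable_lin_form by simp
qed (use assms in simp)

lemma measurable_sample_cov:
  "j < p \<Longrightarrow> k < p \<Longrightarrow> (\<lambda>X. sample_cov n p X $$ (j, k)) \<in> borel_measurable (sample_law n p A)"
  by (auto simp: sample_cov_def intro!: borel_measurable_sum borel_measurable_times measurable_sample_entry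
      borel_measurable_divide)

section \<open>Tail bounds for the entries of the sample covariance\<close>

text \<open>Puts the moment generating function into sub-Gaussian form, through
  \<open>ln (1 - y) \<ge> - y - 2 * y^2\<close>.\<close>

lemma inverse_sqrt_one_minus_le_exp:
  fixes y :: real
  assumes "\<bar>y\<bar> \<le> 1 / 2"
  shows "1 / sqrt (1 - y) \<le> exp ((y + 2 * y\<^sup>2) / 2)"
proof -
  have pos: "1 - y > 0" using assms by simp
  have "- y - 2 * y\<^sup>2 \<le> ln (1 - y)"
  proof (cases "y \<ge> 0")
    case True
    then show ?thesis using assms by (intro ln_one_minus_pos_lower_bound) auto
  next
    case False
    have "- y - 2 * y\<^sup>2 \<le> - y - y\<^sup>2" by simp
    also have "\<dots> \<le> ln (1 - y)" using False assms ln_one_plus_pos_lower_bound[of "-y"] by simp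
    finally show ?thesis .
  qed
  then have "exp (- (y + 2 * y\<^sup>2)) \<le> 1 - y" 
    using pos by (subst exp_ln[OF pos, symmetric]) (simp del: exp_ln)
  then have "sqrt (exp (- (y + 2 * y\<^sup>2))) \<le> sqrt (1 - y)" by simp
  also have "sqrt (exp (- (y + 2 * y\<^sup>2))) = exp (- ((y + 2 * y\<^sup>2) / 2))"
    by (rule real_sqrt_unique) (simp_all add: power2_eq_square flip: exp_add)
  finally have "1 / sqrt (1 - y) \<le> 1 / exp (- ((y + 2 * y\<^sup>2) / 2))"
    using pos by (intro divide_left_mono) auto
  then show ?thesis by (simp only: exp_minus inverse_eq_divide) simp
qed

text \<open>Chernoff's method, with \<open>\<sigma> = 1\<close> for the upper and
  \<open>\<sigma> = -1\<close> for the lower tail. Only an upper bound \<open>V\<close> on the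
  variance enters the rate, so one rate will serve all entries.\<close>

lemma quadratic_form_tail_bound:
  fixes \<sigma> :: real
  assumes A: "pos_def_mat p A" and S: "S \<in> carrier_mat p p" "A * S = 1\<^sub>m p"
    and v: "quad_form p S u \<le> V" and V: "V > 0" and \<eta>: "0 < \<eta>" "\<eta> \<le> V" and n: "n > 0"
    and \<sigma>: "\<bar>\<sigma>\<bar> = 1"
  shows "measure (sample_law n p A) {X \<in> space (sample_law n p A).
           \<sigma> * ((\<Sum>i<n. (lin_form p u (X i))\<^sup>2) / real n - quad_form p S u) \<ge> \<eta>}
         \<le> exp (- (real n * \<eta>\<^sup>2 / (16 * V\<^sup>2)))"
proof -
  let ?M = "sample_law n p A"
  interpret prob_space ?M by (rule prob_space_sample_law[OF A])
  interpret product_sigma_finite "\<lambda>_::nat. gauss_vec p A"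
    using prob_space_gauss_vec[OF A] by (intro product_sigma_finite.intro prob_space_imp_sigma_finite)
  let ?v = "quad_form p S u" and ?W = "\<lambda>X. \<Sum>i<n. (lin_form p u (X i))\<^sup>2"
  \<comment> \<open>This value minimises \<open>\<tau>^2 V^2 - \<tau> \<eta> / 2\<close>, the bound
    on the exponent per observation; \<open>\<eta> \<le> V\<close> keeps
    \<open>t * quad_form p S u\<close> within 1/4 of 0, where
    \<open>inverse_sqrt_one_minus_le_exp\<close> applies.\<close>
  define \<tau> where "\<tau> = \<eta> / (4 * V\<^sup>2)"
  define t where "t = \<sigma> * \<tau>"
  have \<tau>: "\<tau> > 0" using \<eta> V by (simp add: \<tau>_def)
  have v0: "?v \<ge> 0" by (rule pos_def_cauchy_schwarz(1)[OF A S])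
  have tv: "\<bar>t * ?v\<bar> \<le> \<eta> / (4 * V)"
  proof -
    have "\<bar>t * ?v\<bar> = \<tau> * ?v" using \<sigma> \<tau> v0 by (simp add: t_def abs_mult)
    also have "\<dots> \<le> \<tau> * V" using \<tau> v by simp
    also have "\<dots> = \<eta> / (4 * V)" using V by (simp add: \<tau>_def power2_eq_square)
    finally show ?thesis .
  qed
  also have "\<dots> \<le> 1 / 4" using \<eta> V by (simp add: field_simps)
  finally have tv4: "\<bar>t * ?v\<bar> \<le> 1 / 4" .
  have tv2: "(t * ?v)\<^sup>2 \<le> \<eta>\<^sup>2 / (16 * V\<^sup>2)"
    using power_mono[OF tv, of 2] by (simp add: power_divide power_mult_distrib)
  have meas: "(\<lambda>X. lin_form p u (X i)) \<in> borel_measurable ?M" if "i < n" for i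
    using that by (rule measurable_sample_lin_form)
  have Wm [measurable]: "?W \<in> borel_measurable ?M"
    using meas by (intro borel_measurable_sum borel_measurable_power) auto
  have mgf: "(\<integral>\<^sup>+ X. ennreal (exp (t * ?W X / 2)) \<partial>?M) \<le> ennreal (exp (real n * ((t * ?v + 2 * (t * ?v)\<^sup>2) / 2)))"
  proof -
    have "(\<integral>\<^sup>+ X. ennreal (exp (t * ?W X / 2)) \<partial>?M)
        = (\<integral>\<^sup>+ X. (\<Prod>i<n. ennreal (exp (t * (lin_form p u (X i))\<^sup>2 / 2))) \<partial>?M)"
      by (intro nn_integral_cong) (simp add: prod_ennreal exp_sum sum_distrib_left sum_divide_distrib)
    also have "\<dots> = (\<Prod>i<n. \<integral>\<^sup>+ x. ennreal (exp (t * (lin_form p u x)\<^sup>2 / 2)) \<partial>gauss_vec p A)"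
      unfolding sample_law_def by (intro product_nn_integral_prod) auto
    also have "\<dots> = (\<Prod>i<n. ennreal (1 / sqrt (1 - t * ?v)))"
      using tv4 by (intro prod.cong refl nn_integral_exp_square_gauss_vec[OF A S]) auto
    also have "\<dots> = ennreal ((1 / sqrt (1 - t * ?v)) ^ n)"
      using tv4 by (simp add: ennreal_power)
    also have "\<dots> \<le> ennreal (exp ((t * ?v + 2 * (t * ?v)\<^sup>2) / 2) ^ n)"
      using tv4 by (intro ennreal_leI power_mono inverse_sqrt_one_minus_le_exp) auto
    also have "\<dots> = ennreal (exp (real n * ((t * ?v + 2 * (t * ?v)\<^sup>2) / 2)))"
      by (rule arg_cong[of _ _ ennreal, OF exp_of_nat_mult[symmetric]])
    finally show ?thesis .
  qed
  let ?E = "{X \<in> space ?M. \<sigma> * (?W X / real n - ?v) \<ge> \<eta>}"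
  let ?c = "ennreal (exp (- (real n * (t * ?v + \<tau> * \<eta>) / 2)))"
  \<comment> \<open>Markov's inequality is applied to the exponential rescaled by \<open>?c\<close>,
    so that on the event the product is at least 1.\<close>
  have "emeasure ?M ?E \<le> emeasure ?M {X \<in> space ?M. 1 \<le> ?c * ennreal (exp (t * ?W X / 2))}"
  proof (intro emeasure_mono subsetI)
    fix X assume X: "X \<in> ?E"
    have "\<tau> * \<eta> \<le> \<tau> * (\<sigma> * (?W X / real n - ?v))" using X \<tau> by (intro mult_left_mono) auto
    also have "\<dots> = t * ?W X / real n - t * ?v" by (simp add: t_def algebra_simps)
    finally have "real n * (t * ?v + \<tau> * \<eta>) \<le> t * ?W X" using n by (simp add: field_simps)
    then have "1 \<le> exp (- (real n * (t * ?v + \<tau> * \<eta>) / 2)) * exp (t * ?W X / 2)"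
      by (simp flip: exp_add)
    then have "1 \<le> ?c * ennreal (exp (t * ?W X / 2))"
      by (simp flip: ennreal_mult)
    with X show "X \<in> {X \<in> space ?M. 1 \<le> ?c * ennreal (exp (t * ?W X / 2))}" by auto
  qed measurable
  also have "\<dots> \<le> ?c * (\<integral>\<^sup>+ X. ennreal (exp (t * ?W X / 2)) * indicator (space ?M) X \<partial>?M)"
    by (intro nn_integral_Markov_inequality) auto
  also have "(\<integral>\<^sup>+ X. ennreal (exp (t * ?W X / 2)) * indicator (space ?M) X \<partial>?M) = (\<integral>\<^sup>+ X. ennreal (exp (t * ?W X / 2)) \<partial>?M)"
    by (intro nn_integral_cong) simp
  also have "?c * \<dots> \<le> ?c * ennreal (exp (real n * ((t * ?v + 2 * (t * ?v)\<^sup>2) / 2)))"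
    by (intro mult_left_mono mgf) auto
  also have "\<dots> = ennreal (exp (real n * ((t * ?v)\<^sup>2 - \<tau> * \<eta> / 2)))"
    by (simp add: algebra_simps add_divide_distrib diff_divide_distrib flip: ennreal_mult exp_add)
  also have "\<dots> \<le> ennreal (exp (- (real n * \<eta>\<^sup>2 / (16 * V\<^sup>2))))"
  proof -
    have "(t * ?v)\<^sup>2 - \<tau> * \<eta> / 2 \<le> \<eta>\<^sup>2 / (16 * V\<^sup>2) - \<eta>\<^sup>2 / (8 * V\<^sup>2)"
      using tv2 by (simp add: \<tau>_def power2_eq_square)
    also have "\<dots> = - (\<eta>\<^sup>2 / (16 * V\<^sup>2))" using V by (simp add: field_simps)
    finally have "real n * ((t * ?v)\<^sup>2 - \<tau> * \<eta> / 2) \<le> real n * - (\<eta>\<^sup>2 / (16 * V\<^sup>2))"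
      by (intro mult_left_mono) auto
    then show ?thesis by (intro ennreal_leI) simp
  qed
  finally show ?thesis by (simp add: emeasure_eq_measure)
qed

text \<open>By polarisation an entry is a quarter of the difference of the quadratic statistics of
  \<open>e_j + e_k\<close> and \<open>e_j - e_k\<close>. Two tails for each of them and
  \<open>p^2\<close> pairs \<open>(j, k)\<close> give \<open>4 p^2\<close> bad events for the union
  bound.\<close>

lemma sample_cov_concentration:
  assumes A: "pos_def_mat p A" and S: "S \<in> carrier_mat p p" "A * S = 1\<^sub>m p"
    and s: "\<And>j. j < p \<Longrightarrow> S $$ (j, j) \<le> s" and \<epsilon>: "0 < \<epsilon>" "\<epsilon> \<le> 2 * s" and n: "n > 0"
  shows "measure (sample_law n p A) {X \<in> space (sample_law n p A).
           \<forall>j<p. \<forall>k<p. \<bar>sample_cov n p X $$ (j, k) - S $$ (j, k)\<bar> \<le> \<epsilon>}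
         \<ge> 1 - 4 * (real p)\<^sup>2 * exp (- (real n * \<epsilon>\<^sup>2 / (64 * s\<^sup>2)))"
proof -
  let ?M = "sample_law n p A"
  interpret prob_space ?M by (rule prob_space_sample_law[OF A])
  define u where "u j k \<rho> = (\<lambda>i. (if i = j then 1 else 0) + \<rho> * (if i = k then 1 else 0 :: real))" for j k :: nat and \<rho> :: real
  define W where "W j k \<rho> X = (\<Sum>i<n. (lin_form p (u j k \<rho>) (X i))\<^sup>2) / real n" for j k \<rho> and X :: "nat \<Rightarrow> nat \<Rightarrow> real"
  \<comment> \<open>An entry error above \<open>\<epsilon>\<close> makes the two deviations differ
    by more than \<open>4 * \<epsilon>\<close>, so one of them reaches \<open>2 * \<epsilon>\<close>
    in modulus.\<close>
  define bad where "bad = (\<lambda>(j, k, \<rho>, \<sigma>). {X \<in> space ?M. \<sigma> * (W j k \<rho> X - quad_form p S (u j k \<rho>)) \<ge> 2 * \<epsilon>})"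
  define good where "good = {X \<in> space ?M. \<forall>j<p. \<forall>k<p. \<bar>sample_cov n p X $$ (j, k) - S $$ (j, k)\<bar> \<le> \<epsilon>}"
  define I where "I = {..<p} \<times> {..<p} \<times> {1, -1 :: real} \<times> {1, -1 :: real}"
  have s0: "s > 0" using \<epsilon> by simp
  have Ss: "S $$ (j, k) = S $$ (k, j)" if "j < p" "k < p" for j k
    using arg_cong[OF pos_def_inverse[OF A S], of "\<lambda>M. M $$ (j, k)"] that S(1) by simp
  have lf: "lin_form p (u j k \<rho>) x = x j + \<rho> * x k" if "j < p" "k < p" for j k \<rho> x
    using that by (simp add: lin_form_def u_def distrib_right sum.distrib if_distrib[of "\<lambda>z. z * _"]
        if_distrib[of "\<lambda>z. _ * z"] sum_distrib_left[symmetric] mult.assoc cong: if_cong)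
  have qf: "quad_form p S (u j k \<rho>) = S $$ (j, j) + 2 * \<rho> * S $$ (j, k) + \<rho>\<^sup>2 * S $$ (k, k)"
    if jk: "j < p" "k < p" for j k \<rho>
  proof -
    have "quad_form p S (u j k \<rho>) = (\<Sum>i<p. u j k \<rho> i * lin_form p (u j k \<rho>) (\<lambda>l. S $$ (i, l)))"
      by (simp add: quad_form_def lin_form_def sum_distrib_left algebra_simps)
    also have "\<dots> = (\<Sum>i<p. u j k \<rho> i * (S $$ (i, j) + \<rho> * S $$ (i, k)))" by (simp add: lf jk)
    also have "\<dots> = lin_form p (u j k \<rho>) (\<lambda>i. S $$ (i, j) + \<rho> * S $$ (i, k))" by (simp add: lin_form_def)
    also have "\<dots> = S $$ (j, j) + 2 * \<rho> * S $$ (j, k) + \<rho>\<^sup>2 * S $$ (k, k)"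
      using jk Ss[of k j] by (simp add: lf power2_eq_square algebra_simps)
    finally show ?thesis .
  qed
  have qf_le: "quad_form p S (u j k \<rho>) \<le> 4 * s" if jk: "j < p" "k < p" and \<rho>: "\<rho> \<in> {1, -1}" for j k \<rho>
  proof -
    \<comment> \<open>Parallelogram identity: the values for \<open>\<rho>\<close> and
      \<open>- \<rho>\<close> are nonnegative and add up to twice the sum of two diagonal entries of
      \<open>S\<close>, at most \<open>4 * s\<close>.\<close>
    have "0 \<le> quad_form p S (u j k (- \<rho>))" by (rule pos_def_cauchy_schwarz(1)[OF A S])
    then show ?thesis using \<rho> s[OF jk(1)] s[OF jk(2)] by (auto simp: qf jk)
  qed
  have Wm: "W j k \<rho> \<in> borel_measurable ?M" for j k \<rho>
  proof -
    have "(\<lambda>X. lin_form p (u j k \<rho>) (X i)) \<in> borel_measurable ?M" if "i < n" for i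
      using that by (rule measurable_sample_lin_form)
    then show ?thesis unfolding W_def[abs_def]
      by (intro borel_measurable_divide borel_measurable_sum borel_measurable_power) auto
  qed
  have badm: "bad i \<in> sets ?M" for i
  proof -
    obtain j k \<rho> \<sigma> where "i = (j, k, \<rho>, \<sigma>)" by (metis prod_cases4)
    then show ?thesis unfolding bad_def using Wm[of j k \<rho>] by simp
  qed
  have bad_le: "measure ?M (bad i) \<le> exp (- (real n * \<epsilon>\<^sup>2 / (64 * s\<^sup>2)))" if i: "i \<in> I" for i
  proof -
    obtain j k \<rho> \<sigma> where i': "i = (j, k, \<rho>, \<sigma>)" by (metis prod_cases4)
    then have jk: "j < p" "k < p" "\<rho> \<in> {1, -1}" "\<bar>\<sigma>\<bar> = 1" using i by (auto simp: I_def)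
    \<comment> \<open>The tail bound with \<open>\<eta> = 2 * \<epsilon>\<close> and
      \<open>V = 4 * s\<close>; its condition \<open>\<eta> \<le> V\<close> is
      \<open>\<epsilon> \<le> 2 * s\<close>.\<close>
    have "measure ?M (bad i) \<le> exp (- (real n * (2 * \<epsilon>)\<^sup>2 / (16 * (4 * s)\<^sup>2)))"
      unfolding i' bad_def W_def prod.case using qf_le jk \<epsilon> s0 n
      by (intro quadratic_form_tail_bound[OF A S]) auto
    then show ?thesis by (simp add: power_mult_distrib)
  qed
  have goodm: "good \<in> sets ?M"
  proof -
    have "good = {X \<in> space ?M. \<forall>j\<in>{..<p}. \<forall>k\<in>{..<p}. \<bar>sample_cov n p X $$ (j, k) - S $$ (j, k)\<bar> \<le> \<epsilon>}"
      by (auto simp: good_def)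
    also have "\<dots> \<in> sets ?M"
      by (intro sets.sets_Collect_finite_All finite_lessThan borel_measurable_le borel_measurable_abs
          borel_measurable_diff borel_measurable_const measurable_sample_cov) auto
    finally show ?thesis .
  qed
  have sub: "space ?M - good \<subseteq> (\<Union>i\<in>I. bad i)"
  proof
    fix X assume "X \<in> space ?M - good"
    then obtain j k where X: "X \<in> space ?M" and jk: "j < p" "k < p"
      and gt: "\<bar>sample_cov n p X $$ (j, k) - S $$ (j, k)\<bar> > \<epsilon>" by (auto simp: good_def not_le)
    have "W j k 1 X - W j k (-1) X = 4 * sample_cov n p X $$ (j, k)"
    proof -
      have "(\<Sum>i<n. (lin_form p (u j k 1) (X i))\<^sup>2) - (\<Sum>i<n. (lin_form p (u j k (-1)) (X i))\<^sup>2)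
          = 4 * (\<Sum>i<n. X i j * X i k)"
        unfolding sum_subtractf[symmetric] sum_distrib_left
        by (intro sum.cong) (simp_all add: lf jk power2_eq_square algebra_simps)
      then show ?thesis using jk by (simp add: W_def sample_cov_def flip: diff_divide_distrib)
    qed
    moreover have "quad_form p S (u j k 1) - quad_form p S (u j k (-1)) = 4 * S $$ (j, k)"
      using jk by (simp add: qf)
    ultimately have "4 * (sample_cov n p X $$ (j, k) - S $$ (j, k))
        = (W j k 1 X - quad_form p S (u j k 1)) - (W j k (-1) X - quad_form p S (u j k (-1)))" by simp
    then have "4 * \<bar>sample_cov n p X $$ (j, k) - S $$ (j, k)\<bar>
        \<le> \<bar>W j k 1 X - quad_form p S (u j k 1)\<bar> + \<bar>W j k (-1) X - quad_form p S (u j k (-1))\<bar>"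
      by (simp add: abs_if split: if_splits)
    moreover have "a \<ge> 2 * e \<or> b \<ge> 2 * e" if "e < d" "4 * d \<le> a + b" for a b d e :: real
      using that by linarith
    ultimately have "\<bar>W j k 1 X - quad_form p S (u j k 1)\<bar> \<ge> 2 * \<epsilon> \<or> \<bar>W j k (-1) X - quad_form p S (u j k (-1))\<bar> \<ge> 2 * \<epsilon>"
      using gt by blast
    then obtain \<rho> where \<rho>: "\<rho> \<in> {1, -1}" "\<bar>W j k \<rho> X - quad_form p S (u j k \<rho>)\<bar> \<ge> 2 * \<epsilon>" by auto
    then obtain \<sigma> where "\<sigma> \<in> {1, -1}" "\<sigma> * (W j k \<rho> X - quad_form p S (u j k \<rho>)) \<ge> 2 * \<epsilon>"
      by (cases "W j k \<rho> X - quad_form p S (u j k \<rho>) \<ge> 0") force+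
    then have "X \<in> bad (j, k, \<rho>, \<sigma>)" "(j, k, \<rho>, \<sigma>) \<in> I" using X jk \<rho> by (auto simp: bad_def I_def)
    then show "X \<in> (\<Union>i\<in>I. bad i)" by blast
  qed
  have finI: "finite I" by (simp add: I_def)
  have cardI: "card I = 4 * p\<^sup>2" by (simp add: I_def card_cartesian_product power2_eq_square)
  have "measure ?M (space ?M - good) \<le> measure ?M (\<Union>i\<in>I. bad i)"
    using badm finI by (intro finite_measure_mono sub) auto
  also have "\<dots> \<le> (\<Sum>i\<in>I. measure ?M (bad i))"
    using badm finI by (intro finite_measure_subadditive_finite) auto
  also have "\<dots> \<le> (\<Sum>i\<in>I. exp (- (real n * \<epsilon>\<^sup>2 / (64 * s\<^sup>2))))" by (intro sum_mono bad_le)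
  also have "\<dots> = 4 * (real p)\<^sup>2 * exp (- (real n * \<epsilon>\<^sup>2 / (64 * s\<^sup>2)))" by (simp add: cardI)
  finally show ?thesis using prob_compl[OF goodm] unfolding good_def[symmetric] by simp
qed

section \<open>The likelihood gap\<close>

lemma loglik_eq_sum:
  "A \<in> carrier_mat p p \<Longrightarrow> loglik n p X A
    = real n / 2 * (ln (det A) - (\<Sum>i<p. \<Sum>k<p. sample_cov n p X $$ (i, k) * A $$ (k, i)))"
  by (auto simp: loglik_def mat_trace_def sample_cov_def scalar_prod_def atLeast0LessThan)

lemma measurable_loglik:
  assumes "A \<in> carrier_mat p p"
  shows "(\<lambda>X. loglik n p X A) \<in> borel_measurable (sample_law n p Q)"
  unfolding loglik_eq_sum[OF assms]
  by (intro borel_measurable_times borel_measurable_diff borel_measurable_sum borel_measurable_const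
      measurable_sample_cov) auto

text \<open>The likelihood depends continuously on the log-determinant and the entries of its argument,
  so the supremum over a model is already attained on a countable subset.\<close>

lemma measurable_mle_loglik:
  "(\<lambda>X. mle_loglik n p X E) \<in> borel_measurable (sample_law n p Q)"
proof -
  define F where "F A = (ln (det A), \<lambda>(i, k). A $$ (i, k))" for A :: "real mat"
  define G where "G X z = real n / 2 * (fst z - (\<Sum>i<p. \<Sum>k<p. sample_cov n p X $$ (i, k) * snd z (k, i)))"
    for X and z :: "real \<times> (nat \<times> nat \<Rightarrow> real)"
  \<comment> \<open>\<open>F\<close> takes values in a second countable space, so its image of the
    model has a countable dense subset.\<close>
  obtain T where T: "countable T" "T \<subseteq> F ` ggm p E" "F ` ggm p E \<subseteq> closure T"
    using separable[of "F ` ggm p E"] by blast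
  have contG: "continuous_on UNIV (G X)" for X
    unfolding G_def
    by (intro continuous_intros continuous_on_compose2[OF continuous_on_product_coordinates]) auto
  have "loglik n p X A = G X (F A)" if "A \<in> ggm p E" for X A
    using that by (auto simp: ggm_def pos_def_mat_def F_def G_def loglik_eq_sum)
  then have "mle_loglik n p X E = (SUP z \<in> F ` ggm p E. ereal (G X z))" for X
    unfolding mle_loglik_def image_image by (intro SUP_cong) auto
  also have "(SUP z \<in> F ` ggm p E. ereal (G X z)) = (SUP z \<in> T. ereal (G X z))" for X
  proof (rule antisym)
    show "(SUP z \<in> F ` ggm p E. ereal (G X z)) \<le> (SUP z \<in> T. ereal (G X z))"
    proof (rule SUP_least)
      fix z assume "z \<in> F ` ggm p E"
      then have z: "z \<in> closure T" using T by auto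
      have "continuous_on UNIV (\<lambda>z. ereal (G X z))" using contG by (rule continuous_on_ereal)
      \<comment> \<open>The points where \<open>G X\<close> is at most its supremum over
        \<open>T\<close> form a closed set containing \<open>T\<close>, hence also the closure of
        \<open>T\<close>.\<close>
      then have "closed {z. ereal (G X z) \<le> (SUP z \<in> T. ereal (G X z))}"
        by (intro closed_Collect_le continuous_on_const)
      moreover have "T \<subseteq> {z. ereal (G X z) \<le> (SUP z \<in> T. ereal (G X z))}"
        by (auto intro: SUP_upper)
      ultimately show "ereal (G X z) \<le> (SUP z \<in> T. ereal (G X z))"
        using z closure_minimal by blast
    qed
    show "(SUP z \<in> T. ereal (G X z)) \<le> (SUP z \<in> F ` ggm p E. ereal (G X z))"
      using T by (intro SUP_subset_mono) auto
  qed
  finally have eq: "(\<lambda>X. mle_loglik n p X E) = (\<lambda>X. SUP z \<in> T. ereal (G X z))" by blast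
  have "(\<lambda>X. G X z) \<in> borel_measurable (sample_law n p Q)" for z
    unfolding G_def
    by (intro borel_measurable_times borel_measurable_diff borel_measurable_sum borel_measurable_const
        measurable_sample_cov) auto
  then show ?thesis
    unfolding eq using T(1) by (intro borel_measurable_SUP borel_measurable_ereal) auto
qed

lemma finite_all_pairs: "finite (all_pairs p)"
  by (rule finite_subset[of _ "Pow {..<p}"]) (auto simp: all_pairs_def)

lemma finite_edge_sets: "finite {E. edge_set p E}"
proof -
  have "{E. edge_set p E} = Pow (all_pairs p)" by (auto simp: edge_set_def)
  then show ?thesis by (simp add: finite_all_pairs)
qed

text \<open>A finite intersection over the edge sets on \<open>p\<close> nodes. Measurability allows
  the probability of the event to be bounded below by that of a subset.\<close>

lemma sets_likelihood_gap:
  assumes A: "A \<in> carrier_mat p p"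
  shows "{X \<in> space (sample_law n p Q). \<forall>E. edge_set p E \<and> P E \<longrightarrow>
            ereal (loglik n p X A) - mle_loglik n p X E > ereal c} \<in> sets (sample_law n p Q)"
proof -
  have "(\<lambda>X. ereal (loglik n p X A) - mle_loglik n p X E) \<in> borel_measurable (sample_law n p Q)" for E
    by (intro borel_measurable_ereal_diff borel_measurable_ereal measurable_loglik[OF A] measurable_mle_loglik)
  then have "{X \<in> space (sample_law n p Q). \<forall>E \<in> {E. edge_set p E \<and> P E}.
      ereal (loglik n p X A) - mle_loglik n p X E > ereal c} \<in> sets (sample_law n p Q)"
    by (intro sets.sets_Collect_finite_All borel_measurable_less borel_measurable_const
        finite_subset[OF _ finite_edge_sets]) auto
  then show ?thesis by simp
qed

section \<open>Entry bounds, support counts and the deterministic gap\<close>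

lemma pos_def_lambda_max_pos:
  assumes "pos_def_mat p A" "p > 0"
  shows "lambda_max A > 0"
proof -
  obtain L d where d: "\<And>i. i < p \<Longrightarrow> (0::real) < d i" "\<And>i. i < p \<Longrightarrow> d i \<le> lambda_max A"
    using pos_def_factor[OF assms(1)] by metis
  show ?thesis using d[OF assms(2)] by simp
qed

text \<open>The squared norm of row \<open>j\<close> is the entry \<open>(j, j)\<close> of
  \<open>A A = L (L^T L) L^T\<close>, hence at most \<open>lambda_max A * A $$ (j, j)\<close>. The
  purpose is \<open>theta_min \<le> lambda_max\<close>, that is, \<open>r \<le> 1\<close>.\<close>

lemma pos_def_entry_le_lambda_max:
  assumes A: "pos_def_mat p A" and jk: "j < p" "k < p"
  shows "\<bar>A $$ (j, k)\<bar> \<le> lambda_max A"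
proof -
  have A': "A \<in> carrier_mat p p" "transpose_mat A = A" using A by (auto simp: pos_def_mat_def)
  have As: "A $$ (i, l) = A $$ (l, i)" if "i < p" "l < p" for i l
    using arg_cong[OF A'(2), of "\<lambda>M. M $$ (i, l)"] that A'(1) by simp
  obtain L d where L: "L \<in> carrier_mat p p" and AL: "A = L * transpose_mat L"
    and LL: "transpose_mat L * L = mat_diag p d"
    and d: "\<And>i. i < p \<Longrightarrow> 0 < d i" "\<And>i. i < p \<Longrightarrow> d i \<le> lambda_max A"
    using pos_def_factor[OF A] by metis
  note as = assoc_mult_mat[of _ p p _ p _ p]
  have AA: "A * A = L * mat_diag p d * transpose_mat L"
  proof -
    have *: "transpose_mat L * (L * X) = mat_diag p d * X" if "X \<in> carrier_mat p p" for X
      using L that by (simp add: LL flip: as)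
    show ?thesis unfolding AL using L by (simp add: as *)
  qed
  have row: "(\<Sum>k<p. (A $$ (j, k))\<^sup>2) \<le> lambda_max A * A $$ (j, j)"
  proof -
    have "(\<Sum>k<p. (A $$ (j, k))\<^sup>2) = (A * A) $$ (j, j)"
      using A'(1) jk(1) As[of _ j] by (auto simp: scalar_prod_def power2_eq_square atLeast0LessThan intro!: sum.cong)
    also have "\<dots> = (\<Sum>k<p. d k * (L $$ (j, k))\<^sup>2)"
      unfolding AA using L jk(1)
      by (auto simp: mat_diag_mult_right[of _ p p] scalar_prod_def power2_eq_square atLeast0LessThan intro!: sum.cong)
    also have "\<dots> \<le> (\<Sum>k<p. lambda_max A * (L $$ (j, k))\<^sup>2)"
      using d by (intro sum_mono mult_right_mono) auto
    also have "\<dots> = lambda_max A * (\<Sum>k<p. (L $$ (j, k))\<^sup>2)" by (simp add: sum_distrib_left)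
    also have "(\<Sum>k<p. (L $$ (j, k))\<^sup>2) = A $$ (j, j)"
      using L jk(1) unfolding AL
      by (auto simp: scalar_prod_def power2_eq_square atLeast0LessThan intro!: sum.cong)
    finally show ?thesis .
  qed
  have entry: "(A $$ (j, l))\<^sup>2 \<le> lambda_max A * A $$ (j, j)" if "l < p" for l
  proof -
    have "(A $$ (j, l))\<^sup>2 \<le> (\<Sum>k<p. (A $$ (j, k))\<^sup>2)" using that by (intro member_le_sum) auto
    then show ?thesis using row by simp
  qed
  have lam: "lambda_max A > 0" using pos_def_lambda_max_pos[OF A] jk by simp
  \<comment> \<open>The row bound is first applied to the diagonal entry itself: a positive
    \<open>a\<close> with \<open>a^2 \<le> lambda_max A * a\<close> is at most
    \<open>lambda_max A\<close>.\<close>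
  have "A $$ (j, j) \<le> lambda_max A"
  proof (cases "A $$ (j, j) \<le> 0")
    case False
    then show ?thesis using entry[OF jk(1)] by (simp add: power2_eq_square)
  qed (use lam in simp)
  then have "(A $$ (j, k))\<^sup>2 \<le> (lambda_max A)\<^sup>2"
    using order.trans[OF entry[OF jk(2)] mult_left_mono[of "A $$ (j, j)" "lambda_max A" "lambda_max A"]] lam
    by (simp add: power2_eq_square)
  then show ?thesis using lam abs_le_square_iff[of "A $$ (j, k)" "lambda_max A"] by simp
qed

text \<open>The given edge makes the finite set of values nonempty, so \<open>Min\<close> is one of
  its members, and these are nonzero by the support condition.\<close>

lemma theta_min_pos_le:
  assumes supp: "\<And>j k. j < p \<Longrightarrow> k < p \<Longrightarrow> A $$ (j, k) \<noteq> 0 \<longleftrightarrow> (j = k \<or> {j, k} \<in> E0)"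
    and jk: "j < p" "k < p" "{j, k} \<in> E0"
  shows "0 < theta_min p A E0" "theta_min p A E0 \<le> \<bar>A $$ (j, k)\<bar>"
proof -
  let ?V = "{\<bar>A $$ (j, k)\<bar> | j k. j < p \<and> k < p \<and> {j, k} \<in> E0}"
  have "?V = (\<lambda>(j, k). \<bar>A $$ (j, k)\<bar>) ` {(j, k). j < p \<and> k < p \<and> {j, k} \<in> E0}" by auto
  moreover have "finite {(j, k). j < p \<and> k < p \<and> {j, k} \<in> E0}"
    by (rule finite_subset[of _ "{..<p} \<times> {..<p}"]) auto
  ultimately have finV: "finite ?V" by simp
  have inV: "\<bar>A $$ (j, k)\<bar> \<in> ?V" using jk by blast
  show "theta_min p A E0 \<le> \<bar>A $$ (j, k)\<bar>" unfolding theta_min_def using finV inV by (rule Min_le)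
  have "theta_min p A E0 \<in> ?V" unfolding theta_min_def using finV inV by (intro Min_in) auto
  then show "0 < theta_min p A E0" using supp by auto
qed

text \<open>The diagonal contributes \<open>p\<close> positions and every edge two, one per
  orientation.\<close>

lemma card_edge_support_le:
  assumes E: "edge_set p E"
  shows "card {(i, k). i < p \<and> k < p \<and> (i = k \<or> {i, k} \<in> E)} \<le> p + 2 * card E"
proof -
  have finE: "finite E" using E finite_all_pairs unfolding edge_set_def by (rule finite_subset)
  define N where "N e = {x :: nat \<times> nat. {fst x, snd x} = e}" for e
  have pair: "card (N e) \<le> 2 \<and> finite (N e)" if "e \<in> E" for e
  proof -
    have "e \<in> all_pairs p" using that E by (auto simp: edge_set_def)
    then obtain a b where e: "e = {a, b}" unfolding all_pairs_def by blast
    have sub: "N e \<subseteq> {(a, b), (b, a)}" unfolding e N_def by (auto simp: doubleton_eq_iff)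
    have "card {x, y} \<le> 2" for x y :: "nat \<times> nat" by (simp add: card_insert_if)
    then show ?thesis using card_mono[OF _ sub] finite_subset[OF sub] by (meson finite.intros order.trans)
  qed
  have "{(i, k). i < p \<and> k < p \<and> (i = k \<or> {i, k} \<in> E)} \<subseteq> (\<lambda>i. (i, i)) ` {..<p} \<union> (\<Union>e\<in>E. N e)"
    by (auto simp: N_def)
  then have "card {(i, k). i < p \<and> k < p \<and> (i = k \<or> {i, k} \<in> E)}
      \<le> card ((\<lambda>i. (i, i)) ` {..<p} \<union> (\<Union>e\<in>E. N e))"
    by (rule card_mono[rotated]) (use finE pair in auto)
  also have "\<dots> \<le> card ((\<lambda>i. (i, i)) ` {..<p}) + card (\<Union>e\<in>E. N e)" by (rule card_Un_le)
  also have "\<dots> \<le> p + (\<Sum>e\<in>E. card (N e))"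
    using card_image_le[of "{..<p}" "\<lambda>i. (i, i)"] card_UN_le[OF finE, of N] by simp
  also have "\<dots> \<le> p + (\<Sum>e\<in>E. 2)" using pair by (intro add_mono sum_mono) auto
  finally show ?thesis by simp
qed

text \<open>Deterministic core: curvature of order \<open>R^2 / (1 + R)\<close> against a random
  term linear in \<open>R\<close>. A missing edge keeps \<open>R \<ge> r\<close>, and there the
  curvature is at least twice the random term.\<close>

lemma loglik_gap_outside_model:
  assumes A: "pos_def_mat p A"
    and supp: "\<And>j k. j < p \<Longrightarrow> k < p \<Longrightarrow> A $$ (j, k) \<noteq> 0 \<longleftrightarrow> (j = k \<or> {j, k} \<in> E0)"
    and E0: "edge_set p E0" "card E0 \<le> q" and E: "edge_set p E" "card E \<le> q" and nsub: "\<not> E0 \<subseteq> E"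
    and S: "S \<in> carrier_mat p p" "A * S = 1\<^sub>m p"
    and X: "\<And>j k. j < p \<Longrightarrow> k < p \<Longrightarrow> \<bar>sample_cov n p X $$ (j, k) - S $$ (j, k)\<bar> \<le> \<epsilon>"
    and \<Theta>: "\<Theta> \<in> ggm p E"
    and r: "r = theta_min p A E0 / lambda_max A"
    and \<delta>: "\<epsilon> * sqrt (real p + 4 * real q) * lambda_max A \<le> r / 8"
  shows "loglik n p X A - loglik n p X \<Theta> \<ge> real n * r\<^sup>2 / 16"
proof -
  let ?lam = "lambda_max A" and ?\<theta> = "theta_min p A E0"
  let ?C = "sample_cov n p X"
  have A': "A \<in> carrier_mat p p" "transpose_mat A = A" using A by (auto simp: pos_def_mat_def)
  have \<Theta>': "\<Theta> \<in> carrier_mat p p" "transpose_mat \<Theta> = \<Theta>" "pos_def_mat p \<Theta>"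
    and \<Theta>0: "\<And>j k. j < p \<Longrightarrow> k < p \<Longrightarrow> j \<noteq> k \<Longrightarrow> {j, k} \<notin> E \<Longrightarrow> \<Theta> $$ (j, k) = 0"
    using \<Theta> by (auto simp: ggm_def pos_def_mat_def)
  obtain e where e: "e \<in> E0" "e \<notin> E" using nsub by blast
  obtain j k where jk: "e = {j, k}" "j < p" "k < p" "j \<noteq> k"
    using e E0 by (auto simp: edge_set_def all_pairs_def)
  have lam: "?lam > 0" using pos_def_lambda_max_pos[OF A] jk by simp
  have \<theta>: "?\<theta> > 0" and \<theta>_le: "?\<theta> \<le> \<bar>A $$ (j, k)\<bar>"
    using theta_min_pos_le[OF supp jk(2,3)] e(1) unfolding jk(1) by blast+
  have r0: "r > 0" using \<theta> lam r by simp
  have r1: "r \<le> 1"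
    using \<theta>_le pos_def_entry_le_lambda_max[OF A jk(2,3)] lam by (simp add: r)
  define D where "D = \<Theta> - A"
  have D: "D \<in> carrier_mat p p" using A' \<Theta>' by (simp add: D_def minus_carrier_mat)
  have Dij: "D $$ (i, l) = \<Theta> $$ (i, l) - A $$ (i, l)" if "i < p" "l < p" for i l
    using that A' \<Theta>' by (simp add: D_def)
  have AD: "A + D = \<Theta>" using A' \<Theta>' by (auto simp: D_def intro!: eq_matI)
  have Dsym: "transpose_mat D = D" using A' \<Theta>' by (simp add: D_def transpose_minus)
  obtain R where R: "R \<ge> 0"
    "ln (det \<Theta>) - ln (det A) - mat_trace (S * D) \<le> - R\<^sup>2 / (2 * (1 + R))"
    "(\<Sum>i<p. \<Sum>j<p. (D $$ (i, j))\<^sup>2) \<le> (?lam * R)\<^sup>2"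
    using log_det_second_order[OF A _ D Dsym S] \<Theta>'(3) unfolding AD by blast
  have trS: "mat_trace (S * D) = (\<Sum>i<p. \<Sum>l<p. S $$ (i, l) * D $$ (l, i))"
    using S D by (auto simp: mat_trace_def scalar_prod_def atLeast0LessThan)
  \<comment> \<open>Off the diagonal, \<open>D\<close> can be nonzero only at edges of
    \<open>E\<close> or \<open>E0\<close>, of which there are at most \<open>2 * q\<close>; hence at
    most \<open>p + 4 * q\<close> positions.\<close>
  define T where "T = {(i, l). i < p \<and> l < p \<and> (i = l \<or> {i, l} \<in> E \<union> E0)}"
  have T: "T \<subseteq> {..<p} \<times> {..<p}" by (auto simp: T_def)
  have cardT: "real (card T) \<le> real p + 4 * real q"
  proof -
    have "edge_set p (E \<union> E0)" using E E0 by (auto simp: edge_set_def)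
    then have "card T \<le> p + 2 * card (E \<union> E0)" unfolding T_def by (rule card_edge_support_le)
    also have "\<dots> \<le> p + 4 * q" using E E0 card_Un_le[of E E0] by simp
    finally show ?thesis by simp
  qed
  have offT: "D $$ (i, l) = 0" if "i < p" "l < p" "(i, l) \<notin> T" for i l
    using that \<Theta>0[of i l] supp[of i l] by (auto simp: T_def Dij)
  have Ts: "(l, i) \<in> T \<longleftrightarrow> (i, l) \<in> T" for i l by (auto simp: T_def insert_commute)
  have sumT: "(\<Sum>i<p. \<Sum>l<p. f i l * D $$ (l, i)) = (\<Sum>(i, l)\<in>T. f i l * D $$ (l, i))" for f
  proof -
    have "(\<Sum>i<p. \<Sum>l<p. f i l * D $$ (l, i)) = (\<Sum>(i, l)\<in>{..<p} \<times> {..<p}. f i l * D $$ (l, i))"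
      by (rule sum.cartesian_product)
    also have "\<dots> = (\<Sum>(i, l)\<in>T. f i l * D $$ (l, i))"
      using T offT Ts by (intro sum.mono_neutral_right) auto
    finally show ?thesis .
  qed
  have frob: "(\<Sum>(i, l)\<in>T. (D $$ (l, i))\<^sup>2) \<le> (?lam * R)\<^sup>2"
  proof -
    have "(\<Sum>(i, l)\<in>T. (D $$ (l, i))\<^sup>2) = (\<Sum>i<p. \<Sum>l<p. (D $$ (l, i))\<^sup>2)"
      using sumT[of "\<lambda>i l. D $$ (l, i)"] by (simp add: power2_eq_square)
    then show ?thesis using R(3) by (subst (asm) sum.swap) simp
  qed
  \<comment> \<open>The entrywise error \<open>\<epsilon>\<close> multiplies the sum of the moduli
    of \<open>D\<close> over \<open>T\<close>; Cauchy-Schwarz replaces this sum by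
    \<open>sqrt (p + 4 q)\<close> times the Frobenius norm of \<open>D\<close>.\<close>
  have stoch: "\<bar>\<Sum>i<p. \<Sum>l<p. (?C $$ (i, l) - S $$ (i, l)) * D $$ (l, i)\<bar> \<le> r / 8 * R"
  proof -
    have eps: "\<epsilon> \<ge> 0" using X[OF jk(2,3)] by linarith
    have "\<bar>\<Sum>i<p. \<Sum>l<p. (?C $$ (i, l) - S $$ (i, l)) * D $$ (l, i)\<bar>
        \<le> (\<Sum>(i, l)\<in>T. \<bar>(?C $$ (i, l) - S $$ (i, l)) * D $$ (l, i)\<bar>)"
      unfolding sumT by (rule order.trans[OF sum_abs]) (simp add: case_prod_beta)
    also have "\<dots> \<le> (\<Sum>(i, l)\<in>T. \<epsilon> * \<bar>D $$ (l, i)\<bar>)"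
      using T X by (intro sum_mono) (auto simp: abs_mult intro!: mult_right_mono)
    also have "\<dots> = \<epsilon> * (\<Sum>(i, l)\<in>T. \<bar>D $$ (l, i)\<bar>)" by (simp add: sum_distrib_left case_prod_beta)
    also have "\<dots> \<le> \<epsilon> * (sqrt (real p + 4 * real q) * (?lam * R))"
    proof (rule mult_left_mono[OF _ eps], rule power2_le_imp_le)
      have "(\<Sum>(i, l)\<in>T. \<bar>D $$ (l, i)\<bar>)\<^sup>2 = (\<Sum>x\<in>T. 1 * \<bar>D $$ (snd x, fst x)\<bar>)\<^sup>2" by (simp add: case_prod_beta)
      also have "\<dots> \<le> (\<Sum>x\<in>T. 1\<^sup>2) * (\<Sum>x\<in>T. \<bar>D $$ (snd x, fst x)\<bar>\<^sup>2)" by (rule Cauchy_Schwarz_ineq_sum)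
      also have "\<dots> = real (card T) * (\<Sum>(i, l)\<in>T. (D $$ (l, i))\<^sup>2)" by (simp add: case_prod_beta)
      also have "\<dots> \<le> (real p + 4 * real q) * (?lam * R)\<^sup>2"
        using cardT frob by (intro mult_mono) (auto intro: sum_nonneg)
      finally show "(\<Sum>(i, l)\<in>T. \<bar>D $$ (l, i)\<bar>)\<^sup>2 \<le> (sqrt (real p + 4 * real q) * (?lam * R))\<^sup>2"
        by (simp add: power_mult_distrib)
    qed (use lam R in auto)
    also have "\<dots> = \<epsilon> * sqrt (real p + 4 * real q) * ?lam * R" by simp
    also have "\<dots> \<le> r / 8 * R" using \<delta> R(1) by (rule mult_right_mono)
    finally show ?thesis .
  qed
  \<comment> \<open>At an edge of \<open>E0\<close> missing from \<open>E\<close> the entry of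
    \<open>\<Theta>\<close> is 0, so \<open>D\<close> has there the full modulus of the entry of
    \<open>A\<close>, at least \<open>theta_min\<close>; hence \<open>R \<ge> r\<close>.\<close>
  have "(D $$ (j, k))\<^sup>2 \<le> (\<Sum>l<p. (D $$ (j, l))\<^sup>2)" using jk by (intro member_le_sum) auto
  also have "\<dots> \<le> (\<Sum>i<p. \<Sum>l<p. (D $$ (i, l))\<^sup>2)"
    using jk by (intro member_le_sum[of j _ "\<lambda>i. \<Sum>l<p. (D $$ (i, l))\<^sup>2"]) (auto intro: sum_nonneg)
  also note R(3)
  finally have "\<bar>D $$ (j, k)\<bar> \<le> ?lam * R"
    using lam R(1) abs_le_square_iff[of "D $$ (j, k)" "?lam * R"] by simp
  moreover have "D $$ (j, k) = - A $$ (j, k)" using Dij \<Theta>0 e jk by simp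
  ultimately have rR: "r \<le> R" using \<theta>_le lam by (simp add: r field_simps)
  \<comment> \<open>\<open>r \<le> 1\<close> gives \<open>2 * (1 + r) \<le> 4\<close>, and
    \<open>x / (1 + x)\<close> is increasing. Of this \<open>r / 4\<close> the random term consumes
    \<open>r / 8\<close>.\<close>
  have "r / 4 \<le> r / (2 * (1 + r))" using r0 r1 by (intro divide_left_mono) auto
  also have "\<dots> \<le> R / (2 * (1 + R))" using r0 rR by (simp add: field_simps)
  finally have "r / 4 \<le> R / (2 * (1 + R))" .
  then have "r / 8 \<le> R / (2 * (1 + R)) - r / 8" by linarith
  then have RR: "R * (r / 8) \<le> R * (R / (2 * (1 + R)) - r / 8)" using R(1) by (rule mult_left_mono)
  have rr: "r * (r / 8) \<le> R * (r / 8)" using rR r0 by (intro mult_right_mono) auto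
  have "real n * r\<^sup>2 / 16 = real n / 2 * (r * (r / 8))" by (simp add: power2_eq_square)
  also have "\<dots> \<le> real n / 2 * (R * (R / (2 * (1 + R)) - r / 8))"
    by (intro mult_left_mono order.trans[OF rr RR]) auto
  also have "R * (R / (2 * (1 + R)) - r / 8) = R\<^sup>2 / (2 * (1 + R)) - r / 8 * R"
    by (simp add: power2_eq_square algebra_simps)
  also have "real n / 2 * \<dots> \<le> real n / 2 * (- (ln (det \<Theta>) - ln (det A) - mat_trace (S * D))
          + (\<Sum>i<p. \<Sum>l<p. (?C $$ (i, l) - S $$ (i, l)) * D $$ (l, i)))"
    using R(2) stoch by (intro mult_left_mono) auto
  \<comment> \<open>The empirical trace of \<open>D\<close> is the population trace
    \<open>tr (S D)\<close> plus the deviation term.\<close>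
  also have "\<dots> = loglik n p X A - loglik n p X \<Theta>"
    unfolding loglik_eq_sum[OF A'(1)] loglik_eq_sum[OF \<Theta>'(1)] trS
    by (simp add: Dij algebra_simps sum.distrib sum_subtractf)
  finally show ?thesis .
qed

text \<open>An inverse exists, so the choice operator in \<open>cov_mat\<close> picks one.\<close>

lemma cov_mat_inverse:
  assumes A: "pos_def_mat p A"
  shows "cov_mat p A \<in> carrier_mat p p" "A * cov_mat p A = 1\<^sub>m p"
proof -
  obtain S where S: "S \<in> carrier_mat p p" "A * S = 1\<^sub>m p" using pos_def_mat_inverse_exists[OF A] .
  have dim: "dim_row A = p" using A by (auto simp: pos_def_mat_def)
  have "cov_mat p A \<in> carrier_mat p p \<and> inverts_mat A (cov_mat p A)"
    unfolding cov_mat_def by (rule someI[of _ S]) (use S dim in \<open>auto simp: inverts_mat_def\<close>)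
  then show "cov_mat p A \<in> carrier_mat p p" "A * cov_mat p A = 1\<^sub>m p"
    using dim by (auto simp: inverts_mat_def)
qed

lemma cov_mat_diag_le: "j < p \<Longrightarrow> cov_mat p A $$ (j, j) \<le> sigma2_max p A"
proof -
  assume j: "j < p"
  have "{cov_mat p A $$ (j, j) | j. j < p} = (\<lambda>j. cov_mat p A $$ (j, j)) ` {..<p}" by auto
  then show ?thesis unfolding sigma2_max_def using j by (intro Max_ge) auto
qed

text \<open>Cauchy-Schwarz with both vectors equal to \<open>e_0\<close> bounds the product of the
  corner entries of \<open>A\<close> and its inverse below by 1.\<close>

lemma sigma2_max_pos:
  assumes A: "pos_def_mat p A" and p: "p > 0"
  shows "sigma2_max p A > 0"
proof -
  let ?S = "cov_mat p A" and ?u = "\<lambda>i. if i = 0 then 1 else 0 :: real"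
  have q: "quad_form p M ?u = M $$ (0, 0)" for M
  proof -
    have "quad_form p M ?u = (\<Sum>i<p. if i = 0 then M $$ (i, 0) else 0)"
      unfolding quad_form_def
      by (intro sum.cong refl) (use p in \<open>auto simp: if_distrib[of "\<lambda>z. _ * z"] cong: if_cong\<close>)
    then show ?thesis using p by simp
  qed
  have "lin_form p ?u ?u = (\<Sum>i<p. if i = 0 then 1 else 0)"
    unfolding lin_form_def by (intro sum.cong) auto
  then have "lin_form p ?u ?u = 1" using p by simp
  then have "1 \<le> ?S $$ (0, 0) * A $$ (0, 0)"
    using pos_def_cauchy_schwarz(2)[OF A cov_mat_inverse[OF A], of ?u ?u] by (simp add: q)
  moreover have "0 \<le> ?S $$ (0, 0)"
    using pos_def_cauchy_schwarz(1)[OF A cov_mat_inverse[OF A], of ?u] by (simp add: q)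
  ultimately have "0 < ?S $$ (0, 0)" by (cases "?S $$ (0, 0) = 0") auto
  then show ?thesis using cov_mat_diag_le[OF p, of A] by simp
qed

section \<open>Finite-sample probability bound and passage to the limit\<close>

text \<open>Non-asymptotic form, with a small constant \<open>c\<close> in place of the little-o
  condition. The three upper bounds on \<open>c\<close> ensure in turn that the error term is at
  most \<open>r / 8\<close>, that \<open>\<epsilon>\<close> stays in the range of the tail bound,
  and that the gap beats the target with factor \<open>K\<close>.\<close>

lemma prob_likelihood_gap_ge:
  fixes p q n :: nat
  assumes A: "pos_def_mat p A"
    and supp: "\<And>j k. j < p \<Longrightarrow> k < p \<Longrightarrow> A $$ (j, k) \<noteq> 0 \<longleftrightarrow> (j = k \<or> {j, k} \<in> E0)"
    and E0: "edge_set p E0" "card E0 \<le> q"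
    and C: "sigma2_max p A * lambda_max A \<le> C" and K: "K \<ge> 0"
    and n: "n > 0" and p: "p > 1"
    and c: "c > 0" "24576 * C\<^sup>2 * c \<le> 1" "48 * c \<le> 1" "16 * K * c \<le> 1"
    and Q: "(real p + 2 * real q) * ln (real p) * (lambda_max A)\<^sup>2 / (theta_min p A E0)\<^sup>2 \<le> c * real n"
  shows "measure (sample_law n p A) {X \<in> space (sample_law n p A).
      \<forall>E. edge_set p E \<and> \<not> E0 \<subseteq> E \<and> card E \<le> q \<longrightarrow>
        ereal (loglik n p X A) - mle_loglik n p X E > ereal (2 * real q * ln (real p) * K)}
    \<ge> 1 - 4 / real p" (is "measure ?M ?Ev \<ge> _")
proof -
  interpret prob_space ?M by (rule prob_space_sample_law[OF A])
  show ?thesis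
  proof (cases "E0 = {}")
    \<comment> \<open>Every edge set contains the empty one, so the event is the whole space; the
      minimum of an empty set in \<open>theta_min\<close> is thereby avoided.\<close>
    case True
    then have "?Ev = space ?M" by auto
    then show ?thesis by (simp add: prob_space)
  next
    case False
    let ?S = "cov_mat p A" and ?lam = "lambda_max A" and ?s = "sigma2_max p A"
    note S = cov_mat_inverse[OF A]
    define r where "r = theta_min p A E0 / ?lam"
    \<comment> \<open>192 = 3 * 64 makes each of the \<open>4 p\<^sup>2\<close> tail probabilities equal to \<open>p\<^sup>-\<^sup>3\<close>;
      24576 = 2 * 64 * 192 then gives the bound \<open>r / 8\<close> on the error term\<close>
    define \<epsilon> where "\<epsilon> = ?s * sqrt (192 * ln (real p) / real n)"
    have A': "A \<in> carrier_mat p p" using A by (simp add: pos_def_mat_def)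
    have lam: "?lam > 0" using pos_def_lambda_max_pos[OF A] p by simp
    have s: "?s > 0" using sigma2_max_pos[OF A] p by simp
    have lnp: "ln (real p) > 0" using p by simp
    obtain e where e: "e \<in> E0" using False by blast
    then have "e \<in> all_pairs p" using E0 by (auto simp: edge_set_def)
    then obtain j k where jk: "e = {j, k}" "j < p" "k < p" unfolding all_pairs_def by blast
    have th: "theta_min p A E0 > 0" "theta_min p A E0 \<le> ?lam"
      using theta_min_pos_le[OF supp jk(2,3)] e pos_def_entry_le_lambda_max[OF A jk(2,3)]
      unfolding jk(1) by (blast, meson order.trans)
    have r: "r > 0" "r \<le> 1" using th lam by (auto simp: r_def)
    have Qr: "(real p + 2 * real q) * ln (real p) \<le> c * real n * r\<^sup>2"
    proof -
      have "(real p + 2 * real q) * ln (real p) * ?lam\<^sup>2 \<le> c * real n * (theta_min p A E0)\<^sup>2"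
        using Q th by (simp add: pos_divide_le_eq)
      then show ?thesis using lam by (simp add: r_def power_divide pos_le_divide_eq)
    qed
    \<comment> \<open>Equivalent to \<open>192 * ln p / n \<le> 4\<close>, which yields
      \<open>\<epsilon> \<le> 2 * s\<close>.\<close>
    have lnn: "48 * ln (real p) \<le> real n"
    proof -
      have "48 * ln (real p) \<le> 48 * ((real p + 2 * real q) * ln (real p))"
        using lnp p by simp
      also have "\<dots> \<le> 48 * (c * real n * r\<^sup>2)" using Qr by simp
      also have "\<dots> = (48 * c) * (real n * r\<^sup>2)" by simp
      also have "\<dots> \<le> 1 * (real n * 1)"
        using c r by (intro mult_mono) (auto simp: power_le_one)
      finally show ?thesis by simp
    qed
    have \<epsilon>: "0 < \<epsilon>" "\<epsilon> \<le> 2 * ?s"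
    proof -
      show "0 < \<epsilon>" using s lnp n by (simp add: \<epsilon>_def)
      have "192 * ln (real p) / real n \<le> 4" using lnn n by (simp add: field_simps)
      then have "sqrt (192 * ln (real p) / real n) \<le> sqrt 4" by (rule real_sqrt_le_mono)
      then show "\<epsilon> \<le> 2 * ?s" using s by (simp add: \<epsilon>_def)
    qed
    \<comment> \<open>After squaring, the factor \<open>s\<close> in \<open>\<epsilon>\<close> joins
      \<open>lambda_max\<close> to be bounded by \<open>C\<close>, and
      \<open>p + 4 q \<le> 2 (p + 2 q)\<close> makes \<open>Qr\<close> applicable.\<close>
    have \<delta>: "\<epsilon> * sqrt (real p + 4 * real q) * ?lam \<le> r / 8"
    proof (rule power2_le_imp_le)
      have "(\<epsilon> * sqrt (real p + 4 * real q) * ?lam)\<^sup>2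
          = (?s * ?lam)\<^sup>2 * (192 * ((real p + 4 * real q) * ln (real p)) / real n)"
        using lnp by (simp add: \<epsilon>_def power_mult_distrib)
      also have "\<dots> \<le> C\<^sup>2 * (192 * (2 * (c * real n * r\<^sup>2)) / real n)"
      proof (rule mult_mono)
        show "(?s * ?lam)\<^sup>2 \<le> C\<^sup>2" using C s lam by (intro power_mono) auto
        have "(real p + 4 * real q) * ln (real p) \<le> (2 * (real p + 2 * real q)) * ln (real p)"
          using lnp by (intro mult_right_mono) auto
        also have "\<dots> = 2 * ((real p + 2 * real q) * ln (real p))" by (simp only: mult.assoc)
        also have "\<dots> \<le> 2 * (c * real n * r\<^sup>2)" using Qr by (rule mult_left_mono) simp
        finally show "192 * ((real p + 4 * real q) * ln (real p)) / real n \<le> 192 * (2 * (c * real n * r\<^sup>2)) / real n"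
          by (intro divide_right_mono mult_left_mono) auto
      qed (use lnp in auto)
      also have "\<dots> = (24576 * C\<^sup>2 * c) * (r\<^sup>2 / 64)" using n by simp
      also have "\<dots> \<le> 1 * (r\<^sup>2 / 64)" using c by (intro mult_right_mono) auto
      finally show "(\<epsilon> * sqrt (real p + 4 * real q) * ?lam)\<^sup>2 \<le> (r / 8)\<^sup>2" by (simp add: power_divide)
    qed (use r in simp)
    \<comment> \<open>For \<open>K > 0\<close> strictness comes from the surplus
      \<open>p * ln p \<ge> ln p\<close> of \<open>(p + 2 q) * ln p\<close> over
      \<open>2 q * ln p\<close>; for \<open>K = 0\<close> it comes from
      \<open>n * r^2 > 0\<close>.\<close>
    have gap: "2 * real q * ln (real p) * K < real n * r\<^sup>2 / 16"
    proof -
      have "0 < real n * r\<^sup>2" using n r by simp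
      moreover have "16 * K * (c * (real n * r\<^sup>2)) \<le> 1 * (real n * r\<^sup>2)"
        unfolding mult.assoc[symmetric, of _ c] using c n by (intro mult_right_mono) auto
      moreover have "2 * real q * ln (real p) * K \<le> ((real p + 2 * real q) * ln (real p) - ln (real p)) * K"
        using lnp K p by (intro mult_right_mono) (auto simp: algebra_simps)
      moreover have "\<dots> \<le> (c * (real n * r\<^sup>2) - ln (real p)) * K" using Qr K by (intro mult_right_mono) auto
      moreover have "(c * (real n * r\<^sup>2) - ln (real p)) * K = c * (real n * r\<^sup>2) * K - ln (real p) * K"
        by (simp add: algebra_simps)
      moreover have "ln (real p) * K > 0 \<or> K = 0" using lnp K by auto
      ultimately show ?thesis by (auto simp: algebra_simps)
    qed
    define G where "G = {X \<in> space ?M. \<forall>j<p. \<forall>k<p. \<bar>sample_cov n p X $$ (j, k) - ?S $$ (j, k)\<bar> \<le> \<epsilon>}"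
    have "G \<subseteq> ?Ev"
    proof
      fix X assume X: "X \<in> G"
      have "ereal (loglik n p X A) - mle_loglik n p X E > ereal (2 * real q * ln (real p) * K)"
        if E: "edge_set p E" "\<not> E0 \<subseteq> E" "card E \<le> q" for E
      proof -
        \<comment> \<open>The gap is uniform over the model, so it survives the supremum whether or
          not this is attained.\<close>
        have "mle_loglik n p X E \<le> ereal (loglik n p X A - real n * r\<^sup>2 / 16)"
          unfolding mle_loglik_def
        proof (rule SUP_least)
          fix \<Theta> assume "\<Theta> \<in> ggm p E"
          then have "loglik n p X A - loglik n p X \<Theta> \<ge> real n * r\<^sup>2 / 16"
            using X by (intro loglik_gap_outside_model[OF A supp E0 E(1,3,2) S _ _ r_def \<delta>]) (auto simp: G_def)
          then show "ereal (loglik n p X \<Theta>) \<le> ereal (loglik n p X A - real n * r\<^sup>2 / 16)" by simp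
        qed
        then have "ereal (loglik n p X A) - ereal (loglik n p X A - real n * r\<^sup>2 / 16)
            \<le> ereal (loglik n p X A) - mle_loglik n p X E"
          by (intro ereal_minus_mono) auto
        moreover have "ereal (2 * real q * ln (real p) * K) < ereal (loglik n p X A) - ereal (loglik n p X A - real n * r\<^sup>2 / 16)"
          using gap by simp
        ultimately show ?thesis by (rule less_le_trans[rotated])
      qed
      then show "X \<in> ?Ev" using X by (auto simp: G_def)
    qed
    then have "measure ?M G \<le> measure ?M ?Ev"
      by (intro finite_measure_mono sets_likelihood_gap[OF A'])
    moreover have "measure ?M G \<ge> 1 - 4 * (real p)\<^sup>2 * exp (- (real n * \<epsilon>\<^sup>2 / (64 * ?s\<^sup>2)))"
      unfolding G_def using sample_cov_concentration[OF A S cov_mat_diag_le \<epsilon> n] by blast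
    moreover have "4 * (real p)\<^sup>2 * exp (- (real n * \<epsilon>\<^sup>2 / (64 * ?s\<^sup>2))) = 4 / real p"
    proof -
      have "real n * \<epsilon>\<^sup>2 / (64 * ?s\<^sup>2) = 3 * ln (real p)"
        using s n lnp by (simp add: \<epsilon>_def power_mult_distrib)
      also have "\<dots> = ln (real p ^ 3)" using p by (simp add: ln_realpow)
      finally have "exp (- (real n * \<epsilon>\<^sup>2 / (64 * ?s\<^sup>2))) = 1 / real p ^ 3"
        using p by (simp add: exp_minus inverse_eq_divide)
      then show ?thesis using p by (simp add: power2_eq_square power3_eq_cube)
    qed
    ultimately show ?thesis by linarith
  qed
qed

theorem theorem1:
  fixes p q :: "nat \<Rightarrow> nat" and E0 :: "nat \<Rightarrow> nat set set"
    and Theta0 :: "nat \<Rightarrow> real mat" and C kappa gamma :: real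
  assumes C_pos: "C > 0" and kappa_pos: "kappa > 0"
    and Theta0: "\<forall>n. pos_def_mat (p n) (Theta0 n) \<and>
        (\<forall>j < p n. \<forall>k < p n. Theta0 n $$ (j, k) \<noteq> 0 \<longleftrightarrow> (j = k \<or> {j, k} \<in> E0 n))"
    and E0: "\<forall>n. edge_set (p n) (E0 n)"
    and i: "\<forall>n. decomposable (E0 n) \<and> card (E0 n) \<le> q n"
    and ii: "\<forall>n. sigma2_max (p n) (Theta0 n) * lambda_max (Theta0 n) \<le> C"
    and iii: "(\<lambda>n. real (p n)) \<in> O(\<lambda>n. real n powr kappa)" "filterlim p at_top sequentially"
    and iv: "gamma - (1 - 1 / (4 * kappa)) > 0"
    and v: "(\<lambda>n. (real (p n) + 2 * real (q n)) * ln (real (p n)) *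
              (lambda_max (Theta0 n))\<^sup>2 / (theta_min (p n) (Theta0 n) (E0 n))\<^sup>2)
            \<in> o(\<lambda>n. real n)"
  shows "(\<lambda>n. measure (sample_law n (p n) (Theta0 n))
           {X \<in> space (sample_law n (p n) (Theta0 n)).
             \<forall>E. edge_set (p n) E \<and> \<not> E0 n \<subseteq> E \<and> card E \<le> q n \<longrightarrow>
               ereal (loglik n (p n) X (Theta0 n)) - mle_loglik n (p n) X E
                 > ereal (2 * real (q n) * ln (real (p n)) * (1 + (gamma - (1 - 1 / (4 * kappa)))))})
         \<longlonglongrightarrow> 1"
    (is "(\<lambda>n. measure (?M n) (?Ev n)) \<longlonglongrightarrow> 1")
proof (rule tendsto_sandwich)
  define K where "K = 1 + (gamma - (1 - 1 / (4 * kappa)))"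
  have K: "K > 0" using iv by (simp add: K_def)
  \<comment> \<open>The minimum of the three bounds demanded by
    \<open>prob_likelihood_gap_ge\<close>. It is positive and independent of \<open>n\<close>, hence
    an admissible constant in the little-o condition.\<close>
  define c where "c = min (1 / (24576 * C\<^sup>2)) (min (1 / 48) (1 / (16 * K)))"
  have c: "c > 0" using C_pos K by (simp add: c_def)
  have c': "24576 * C\<^sup>2 * c \<le> 1" "48 * c \<le> 1" "16 * K * c \<le> 1"
  proof -
    have "c \<le> 1 / (24576 * C\<^sup>2)" "c \<le> 1 / 48" "c \<le> 1 / (16 * K)" by (auto simp: c_def)
    then show "24576 * C\<^sup>2 * c \<le> 1" "48 * c \<le> 1" "16 * K * c \<le> 1"
      using C_pos K by (simp_all add: field_simps)
  qed
  have "\<forall>\<^sub>F n in sequentially. 2 \<le> p n"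
    using iii(2) by (simp add: filterlim_at_top)
  then have "\<forall>\<^sub>F n in sequentially. p n > 1"
    by eventually_elim simp
  moreover have "\<forall>\<^sub>F n in sequentially. n > (0::nat)" by (rule eventually_gt_at_top)
  moreover have "\<forall>\<^sub>F n in sequentially. norm ((real (p n) + 2 * real (q n)) * ln (real (p n)) *
      (lambda_max (Theta0 n))\<^sup>2 / (theta_min (p n) (Theta0 n) (E0 n))\<^sup>2) \<le> c * norm (real n)"
    using landau_o.smallD[OF v c] .
  ultimately show "\<forall>\<^sub>F n in sequentially. 1 - 4 / real (p n) \<le> measure (?M n) (?Ev n)"
  proof eventually_elim
    case (elim n)
    show ?case
      unfolding K_def[symmetric]
    proof (rule prob_likelihood_gap_ge[where C = C and c = c])
      show "(real (p n) + 2 * real (q n)) * ln (real (p n)) *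
          (lambda_max (Theta0 n))\<^sup>2 / (theta_min (p n) (Theta0 n) (E0 n))\<^sup>2 \<le> c * real n"
        by (rule order.trans[OF abs_ge_self elim(3)[unfolded real_norm_def abs_of_nat]])
    qed (use Theta0 E0 i ii K elim c c' in auto)
  qed
  show "\<forall>\<^sub>F n in sequentially. measure (?M n) (?Ev n) \<le> 1"
    using Theta0 by (intro always_eventually allI prob_space.prob_le_1 prob_space_sample_law) blast
  have "filterlim (\<lambda>n. real (p n)) at_top sequentially"
    by (rule filterlim_compose[OF filterlim_real_sequentially iii(2)])
  then have "(\<lambda>n. 4 / real (p n)) \<longlonglongrightarrow> 0"
    by (intro tendsto_divide_0[OF tendsto_const] filterlim_at_top_imp_at_infinity)
  then show "(\<lambda>n. 1 - 4 / real (p n)) \<longlonglongrightarrow> 1"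
    using tendsto_diff[OF tendsto_const, of _ 0 sequentially 1] by simp
qed simp

end
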